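(* There exist a $\mathcal{C}^\infty$ function $F : [-1,1]^2 \to \mathbb{R}$ with a unique critical point at the origin (i.e. the origin is the only point of $[-1,1]^2$ at which $\nabla F = 0$), and a constant $0 < C < +\infty$, such that for every $x, y \in [-1,1]$, $$\partial_x^2 F(x,y) \ge C^{-1} \quad\text{and}\quad \sup_{y' \in [-1,1]} F(x,y') - F(x,y) \le C\, |\partial_y F(x,y)|^2,$$ and yet, for every $z(0)$ in some non-empty open subset of $[-1,1]^2$, the gradient descent-ascent flow $(z(t))_{t \ge 0}$ of $F$ started from $z(0)$ is periodic.
   Context: The gradient descent-ascent (GDA) flow of a function $F(x,y)$, $(x,y) \in [-1,1]^2$, started from $z(0)$ is the solution $(z(t))_{t \ge 0}$, with values in $[-1,1]^2$, of the ordinary differential equation $$\partial_t z(t) = \begin{pmatrix} -\partial_x F \\ \partial_y F \end{pmatrix}(z(t)).$$ Derivatives at boundary points of the square are understood as one-sided. *)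

theory Defs
  imports "HOL-Analysis.Analysis"
begin

abbreviation square :: "(real \<times> real) set" where
  "square \<equiv> {-1..1} \<times> {-1..1}"

text \<open>
  Functions on the square are total functions on the plane of which only the values on the square
  matter: all limits below are taken within \<open>{-1..1}\<close>, so that derivatives at boundary points
  are one-sided. Outside the square (or where the limit does not exist) the two operators
  return unspecified values.
\<close>

definition partial_x :: "(real \<times> real \<Rightarrow> real) \<Rightarrow> real \<times> real \<Rightarrow> real" where
  "partial_x F = (\<lambda>(x, y). vector_derivative (\<lambda>s. F (s, y)) (at x within {-1..1}))"

definition partial_y :: "(real \<times> real \<Rightarrow> real) \<Rightarrow> real \<times> real \<Rightarrow> real" where
  "partial_y F = (\<lambda>(x, y). vector_derivative (\<lambda>s. F (x, s)) (at y within {-1..1}))"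

primrec Ck_on_square :: "nat \<Rightarrow> (real \<times> real \<Rightarrow> real) \<Rightarrow> bool" where
  "Ck_on_square 0 F \<longleftrightarrow> continuous_on square F"
| "Ck_on_square (Suc k) F \<longleftrightarrow>
     continuous_on square F \<and>
     (\<forall>x\<in>{-1..1}. \<forall>y\<in>{-1..1}.
        (\<lambda>s. F (s, y)) differentiable (at x within {-1..1}) \<and>
        (\<lambda>s. F (x, s)) differentiable (at y within {-1..1})) \<and>
     Ck_on_square k (partial_x F) \<and> Ck_on_square k (partial_y F)"

definition smooth_on_square :: "(real \<times> real \<Rightarrow> real) \<Rightarrow> bool" where
  "smooth_on_square F \<longleftrightarrow> (\<forall>k. Ck_on_square k F)"

definition critical_point :: "(real \<times> real \<Rightarrow> real) \<Rightarrow> real \<times> real \<Rightarrow> bool" where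
  "critical_point F p \<longleftrightarrow> p \<in> square \<and> partial_x F p = 0 \<and> partial_y F p = 0"

definition gda_flow ::
  "(real \<times> real \<Rightarrow> real) \<Rightarrow> real \<times> real \<Rightarrow> (real \<Rightarrow> real \<times> real) \<Rightarrow> bool" where
  "gda_flow F z0 z \<longleftrightarrow>
     z 0 = z0 \<and>
     (\<forall>t\<ge>0. z t \<in> square \<and>
        (z has_vector_derivative (- partial_x F (z t), partial_y F (z t))) (at t within {0..}))"

definition periodic_flow :: "(real \<Rightarrow> 'a) \<Rightarrow> bool" where
  "periodic_flow z \<longleftrightarrow> (\<exists>T>0. \<forall>t\<ge>0. z (t + T) = z t)"

end

theory Submission
  imports Defs
begin

text \<open>
  The descent-ascent fields of \<open>F\<close> and of \<open>\<phi> \<circ> F\<close>, for increasing \<open>\<phi>\<close>, have the same orbits. Taking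
  \<open>F = exp (K * Z)\<close> with \<open>K\<close> large, convexity of \<open>F\<close> in \<open>x\<close> requires only that \<open>Z\<close> is strictly
  convex in \<open>x\<close> where its \<open>x\<close>-slope is small; likewise the gap inequality in \<open>y\<close> requires only
  strict concavity in \<open>y\<close> where the \<open>y\<close>-slope is small
  (\<open>exponential_of_saddle_is_convex_PL\<close>). This leaves much freedom for \<open>Z\<close>.

  Start from \<open>x * y\<close>, whose flow consists of circles around the origin. Its \<open>x\<close>-slope is small near the axis
  \<open>y = 0\<close> and its \<open>y\<close>-slope is small near the axis \<open>x = 0\<close>. Adding \<open>\<epsilon> * \<tau> * (x\<^sup>2 - y\<^sup>2)\<close> gives the right curvature there, but
  makes the flow spiral into the origin. To compensate, subtract
  \<open>4 * \<epsilon> * (x\<^sup>2 - y\<^sup>2) * x\<^sup>2 * y\<^sup>2 / (x\<^sup>2 + y\<^sup>2)\<^sup>2\<close>, which pushes outwards on average and, being divisible by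
  \<open>x\<^sup>2 * y\<^sup>2\<close>, does not affect the curvatures at the axes. It is singular at the origin, so it is modified
  inside a small disc.

  Outside the disc the resulting \<open>Z\<close> is homogeneous of degree 2. Its flow there commutes with dilations, so either all
  orbits in a ring around the origin are closed or none is. Closedness is one scalar equation, linear in
  \<open>\<tau>\<close>, and its solution is close to \<open>1 / 4\<close> for small \<open>\<epsilon>\<close> (\<open>closing_coefficient_exists\<close>).
  The closed curves are known explicitly in polar coordinates; a change of time turns them into
  periodic flows (\<open>closed_orbit_reparametrization\<close>), and by uniqueness these are all the flows that start in
  the ring (\<open>flow_unique\<close>). Finally, the gradient of \<open>Z\<close> differs from \<open>(y, x)\<close> by
  at most a small multiple of the distance from the origin, so it vanishes only there.
\<close>

section \<open>Elementary smooth functions on the plane\<close>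

text \<open>
  Dividing \<open>exp (- 1 / t)\<close> by powers of \<open>t\<close> makes the family closed under differentiation up to
  linear combinations, so smoothness needs no separate treatment of higher derivatives.
\<close>

definition flat :: "nat \<Rightarrow> real \<Rightarrow> real" where
  "flat n t = (if 0 < t then exp (- (1 / t)) / t ^ n else 0)"

lemma flat_eq_0: "t \<le> 0 \<Longrightarrow> flat n t = 0"
  and flat_pos: "0 < t \<Longrightarrow> 0 < flat n t"
  by (simp_all add: flat_def)

lemma power_over_fact_le_exp:
  assumes "0 \<le> (x::real)"
  shows "x ^ m / fact m \<le> exp x"
  using sum_le_suminf[OF sums_summable[OF exp_converges[of x]], of "{m}"]
    sums_unique[OF exp_converges[of x]] assms
  by (simp add: scaleR_conv_of_real divide_inverse mult.commute)

text \<open>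
  The only use is that the difference quotients of \<open>flat n\<close> at \<open>0\<close> tend to \<open>0\<close>; two powers of \<open>t\<close>
  leave one to spare.
\<close>

lemma flat_le_square: "\<bar>flat n t\<bar> \<le> fact (n + 2) * t\<^sup>2"
proof (cases "0 < t")
  case True
  have "exp (- (1 / t)) * ((1 / t) ^ (n + 2) / fact (n + 2)) \<le> exp (- (1 / t)) * exp (1 / t)"
    using True by (intro mult_left_mono power_over_fact_le_exp) auto
  also have "\<dots> = 1" by (simp flip: exp_add)
  finally have "exp (- (1 / t)) \<le> fact (n + 2) * t ^ (n + 2)"
    using True by (simp add: field_simps del: fact_Suc)
  then show ?thesis
    using True by (simp add: flat_def divide_le_eq power_add power2_eq_square mult_ac del: fact_Suc)
qed (simp add: flat_def)

lemma has_real_derivative_flat: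
  "(flat n has_real_derivative flat (n + 2) t - real n * flat (n + 1) t) (at t)"
proof -
  consider "t < 0" | "t = 0" | "0 < t" by linarith
  then show ?thesis
  proof cases
    case 1
    have "((\<lambda>_. 0) has_real_derivative 0) (at t)" by simp
    then have "(flat n has_real_derivative 0) (at t)"
      by (rule has_field_derivative_transform_within_open[of _ _ _ "{..<0}"])
        (use 1 in \<open>auto simp: flat_def\<close>)
    then show ?thesis using 1 by (simp add: flat_def)
  next
    case 2
    have "(flat n has_real_derivative 0) (at 0)"
      unfolding has_field_derivative_iff
    proof (rule Lim_null_comparison)
      show "\<forall>\<^sub>F h in at 0. norm ((flat n h - flat n 0) / (h - 0)) \<le> fact (n + 2) * \<bar>h\<bar>"
      proof (rule eventually_at_topological[THEN iffD2], intro exI[of _ UNIV] conjI ballI impI)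
        fix h :: real assume "h \<noteq> 0"
        then show "norm ((flat n h - flat n 0) / (h - 0)) \<le> fact (n + 2) * \<bar>h\<bar>"
          using flat_le_square[of n h]
          by (simp add: flat_def[of _ 0] abs_divide divide_le_eq power2_eq_square abs_mult[symmetric] mult.assoc del: fact_Suc)
      qed auto
      show "((\<lambda>h::real. fact (n + 2) * \<bar>h\<bar>) \<longlongrightarrow> 0) (at 0)"
        by (rule tendsto_eq_intros refl tendsto_rabs_zero | simp)+
    qed
    then show ?thesis using 2 by (simp add: flat_def)
  next
    case 3
    have "real n * t ^ (n - 1) = real n * t ^ n / t" using 3 by (cases n) auto
    then have "(exp (- (1 / t)) * (1 / t\<^sup>2) * t ^ n - exp (- (1 / t)) * (real n * t ^ (n - 1))) / (t ^ n * t ^ n)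
        = flat (n + 2) t - real n * flat (n + 1) t"
      using 3 by (simp only:) (simp add: flat_def field_simps power2_eq_square)
    moreover have "((\<lambda>t. exp (- (1 / t)) / t ^ n) has_real_derivative
        (exp (- (1 / t)) * (1 / t\<^sup>2) * t ^ n - exp (- (1 / t)) * (real n * t ^ (n - 1))) / (t ^ n * t ^ n)) (at t)"
      using 3 by (auto intro!: derivative_eq_intros simp: power2_eq_square)
    ultimately have "((\<lambda>t. exp (- (1 / t)) / t ^ n) has_real_derivative
            flat (n + 2) t - real n * flat (n + 1) t) (at t)"
      by simp
    then show ?thesis
      by (rule has_field_derivative_transform_within_open[of _ _ _ "{0<..}"])
        (use 3 in \<open>auto simp: flat_def\<close>)
  qed
qed

definition has_partials ::
  "(real \<times> real \<Rightarrow> real) \<Rightarrow> (real \<times> real \<Rightarrow> real) \<Rightarrow> (real \<times> real \<Rightarrow> real) \<Rightarrow> bool" where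
  "has_partials f fx fy \<longleftrightarrow>
     (\<forall>x y. ((\<lambda>s. f (s, y)) has_real_derivative fx (x, y)) (at x) \<and>
            ((\<lambda>s. f (x, s)) has_real_derivative fy (x, y)) (at y))"

text \<open>
  This is not the class of all smooth functions on the plane, only an algebra of elementary ones
  that is closed under partial differentiation, which makes every member smooth.
\<close>

inductive_set plane_smooth :: "(real \<times> real \<Rightarrow> real) set" where
  const: "(\<lambda>_. a) \<in> plane_smooth"
| fst: "fst \<in> plane_smooth"
| snd: "snd \<in> plane_smooth"
| add: "f \<in> plane_smooth \<Longrightarrow> g \<in> plane_smooth \<Longrightarrow> (\<lambda>p. f p + g p) \<in> plane_smooth"
| mult: "f \<in> plane_smooth \<Longrightarrow> g \<in> plane_smooth \<Longrightarrow> (\<lambda>p. f p * g p) \<in> plane_smooth"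
| inverse: "f \<in> plane_smooth \<Longrightarrow> (\<And>p. f p \<noteq> 0) \<Longrightarrow> (\<lambda>p. inverse (f p)) \<in> plane_smooth"
| exp: "f \<in> plane_smooth \<Longrightarrow> (\<lambda>p. exp (f p)) \<in> plane_smooth"
| flat: "f \<in> plane_smooth \<Longrightarrow> (\<lambda>p. flat n (f p)) \<in> plane_smooth"

lemma plane_smooth_diff:
  assumes "f \<in> plane_smooth" "g \<in> plane_smooth"
  shows "(\<lambda>p. f p - g p) \<in> plane_smooth"
  using plane_smooth.add[OF assms(1) plane_smooth.mult[OF plane_smooth.const[of "-1"] assms(2)]]
  by simp

lemma plane_smooth_power: "f \<in> plane_smooth \<Longrightarrow> (\<lambda>p. f p ^ n) \<in> plane_smooth"
  by (induction n) (auto intro: plane_smooth.intros)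

lemmas plane_smooth_intros = plane_smooth.intros plane_smooth_diff plane_smooth_power

lemma plane_smooth_continuous: "f \<in> plane_smooth \<Longrightarrow> continuous_on S f"
proof (induction rule: plane_smooth.induct)
  case (flat f n)
  have "continuous_on UNIV (flat n)"
    by (intro continuous_at_imp_continuous_on ballI DERIV_isCont[OF has_real_derivative_flat])
  then show ?case
    by (rule continuous_on_compose2) (use flat in auto)
qed (auto intro!: continuous_intros)

lemma plane_smooth_has_partials:
  "f \<in> plane_smooth \<Longrightarrow> \<exists>fx\<in>plane_smooth. \<exists>fy\<in>plane_smooth. has_partials f fx fy"
proof (induction rule: plane_smooth.induct)
  case (const a)
  then show ?case
    by (intro bexI[of _ "\<lambda>_. 0"]) (auto simp: has_partials_def intro: plane_smooth_intros)
next
  case fst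
  then show ?case
    by (intro bexI[of _ "\<lambda>_. 0"] bexI[of _ "\<lambda>_. 1"]) (auto simp: has_partials_def intro: plane_smooth_intros)
next
  case snd
  then show ?case
    by (intro bexI[of _ "\<lambda>_. 0"] bexI[of _ "\<lambda>_. 1"]) (auto simp: has_partials_def intro: plane_smooth_intros)
next
  case (add f g)
  then obtain fx fy gx gy where *: "fx \<in> plane_smooth" "fy \<in> plane_smooth" "has_partials f fx fy"
    "gx \<in> plane_smooth" "gy \<in> plane_smooth" "has_partials g gx gy" by blast
  show ?case
    by (intro bexI[of _ "\<lambda>p. fx p + gx p"] bexI[of _ "\<lambda>p. fy p + gy p"])
      (use * in \<open>auto simp: has_partials_def intro!: plane_smooth_intros derivative_eq_intros\<close>)
next
  case (mult f g)
  then obtain fx fy gx gy where *: "fx \<in> plane_smooth" "fy \<in> plane_smooth" "has_partials f fx fy"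
    "gx \<in> plane_smooth" "gy \<in> plane_smooth" "has_partials g gx gy" by blast
  show ?case
    by (intro bexI[of _ "\<lambda>p. fx p * g p + gx p * f p"] bexI[of _ "\<lambda>p. fy p * g p + gy p * f p"])
      (use * mult.hyps in \<open>auto simp: has_partials_def intro!: plane_smooth_intros DERIV_mult\<close>)
next
  case (inverse f)
  then obtain fx fy where *: "fx \<in> plane_smooth" "fy \<in> plane_smooth" "has_partials f fx fy" by blast
  let ?d = "\<lambda>p. - 1 * inverse (f p) ^ 2"
  have "?d \<in> plane_smooth" using inverse.hyps by (intro plane_smooth_intros)
  moreover have "has_partials (\<lambda>p. inverse (f p)) (\<lambda>p. ?d p * fx p) (\<lambda>p. ?d p * fy p)"
    using *(3) inverse.hyps(2)
    by (auto simp: has_partials_def power2_eq_square intro!: derivative_eq_intros)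
  ultimately show ?case
    using plane_smooth.mult[OF _ *(1)] plane_smooth.mult[OF _ *(2)] by blast
next
  case (exp f)
  then obtain fx fy where *: "fx \<in> plane_smooth" "fy \<in> plane_smooth" "has_partials f fx fy" by blast
  show ?case
    by (intro bexI[of _ "\<lambda>p. exp (f p) * fx p"] bexI[of _ "\<lambda>p. exp (f p) * fy p"])
      (use * exp in \<open>auto simp: has_partials_def intro!: plane_smooth_intros derivative_eq_intros\<close>)
next
  case (flat f n)
  then obtain fx fy where *: "fx \<in> plane_smooth" "fy \<in> plane_smooth" "has_partials f fx fy" by blast
  let ?d = "\<lambda>p. flat (n + 2) (f p) - real n * flat (n + 1) (f p)"
  have "?d \<in> plane_smooth" using flat.hyps by (intro plane_smooth_intros)
  moreover have "has_partials (\<lambda>p. flat n (f p)) (\<lambda>p. ?d p * fx p) (\<lambda>p. ?d p * fy p)"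
    using *(3) unfolding has_partials_def
    by (intro allI conjI DERIV_chain2[OF has_real_derivative_flat]) simp_all
  ultimately show ?case
    using plane_smooth.mult[OF _ *(1)] plane_smooth.mult[OF _ *(2)] by blast
qed

lemma partials_eqI:
  assumes x: "x \<in> {-1..1::real}" and f: "(f has_real_derivative d) (at x)"
  shows "vector_derivative f (at x within {-1..1}) = d"
  using f x
  by (intro vector_derivative_within_cbox[of "-1" 1 _ f, unfolded box_real])
     (auto simp: has_real_derivative_iff_has_vector_derivative has_vector_derivative_at_within)

lemma partial_eq:
  assumes "has_partials f fx fy" "x \<in> {-1..1}" "y \<in> {-1..1}"
  shows "partial_x f (x, y) = fx (x, y)" "partial_y f (x, y) = fy (x, y)"
  using assms by (auto simp: partial_x_def partial_y_def has_partials_def intro!: partials_eqI)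

text \<open>
  \<open>partial_x f\<close> agrees with the derivative of \<open>f\<close> on the square only, so iterated one-sided
  derivatives can be computed only if differentiation respects equality on the square.
\<close>

lemma vector_derivative_cong_on:
  assumes "\<And>s. s \<in> S \<Longrightarrow> f s = g s" "x \<in> S"
  shows "vector_derivative f (at x within S) = vector_derivative g (at x within S)"
proof -
  have "(f has_vector_derivative d) (at x within S) \<longleftrightarrow> (g has_vector_derivative d) (at x within S)" for d
    using assms by (metis (no_types, lifting) has_vector_derivative_transform)
  then show ?thesis by (simp add: vector_derivative_def)
qed

lemma partial_cong:
  assumes "\<And>p. p \<in> square \<Longrightarrow> f p = g p" "p \<in> square"
  shows "partial_x f p = partial_x g p" "partial_y f p = partial_y g p"
  using assms by (auto simp: partial_x_def partial_y_def intro!: vector_derivative_cong_on)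

lemma Ck_on_square_cong:
  "(\<And>p. p \<in> square \<Longrightarrow> f p = g p) \<Longrightarrow> Ck_on_square k f \<Longrightarrow> Ck_on_square k g"
proof (induction k arbitrary: f g)
  case 0
  then show ?case using continuous_on_cong[of square square f g] by auto
next
  case (Suc k)
  have eq: "\<And>x y. x \<in> {-1..1} \<Longrightarrow> y \<in> {-1..1} \<Longrightarrow> f (x, y) = g (x, y)" using Suc.prems(1) by auto
  have "continuous_on square g"
    using Suc.prems continuous_on_cong[of square square f g] by auto
  moreover have "(\<lambda>s. g (s, y)) differentiable (at x within {-1..1})"
    "(\<lambda>s. g (x, s)) differentiable (at y within {-1..1})"
    if "x \<in> {-1..1}" "y \<in> {-1..1}" for x y
  proof -
    have "(\<lambda>s. f (s, y)) differentiable (at x within {-1..1})"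
      "(\<lambda>s. f (x, s)) differentiable (at y within {-1..1})" using Suc.prems that by auto
    then show "(\<lambda>s. g (s, y)) differentiable (at x within {-1..1})"
      "(\<lambda>s. g (x, s)) differentiable (at y within {-1..1})"
      using that eq unfolding differentiable_def
      by (metis (no_types, lifting) has_derivative_transform)+
  qed
  moreover have "Ck_on_square k (partial_x g)" "Ck_on_square k (partial_y g)"
    using Suc.IH[of "partial_x f" "partial_x g"] Suc.IH[of "partial_y f" "partial_y g"]
      partial_cong[of f g] Suc.prems by auto
  ultimately show ?case by simp
qed

text \<open>
  Induction on the order of differentiability, for all members of the class at once: the partial
  derivatives are again members.
\<close>

lemma plane_smooth_imp_smooth_on_square:
  assumes "f \<in> plane_smooth"
  shows "smooth_on_square f"
proof -
  have "f \<in> plane_smooth \<Longrightarrow> Ck_on_square k f" for k f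
  proof (induction k arbitrary: f)
    case 0
    then show ?case by (simp add: plane_smooth_continuous)
  next
    case (Suc k)
    then obtain fx fy where *: "fx \<in> plane_smooth" "fy \<in> plane_smooth" "has_partials f fx fy"
      using plane_smooth_has_partials by blast
    have "Ck_on_square k (partial_x f)" "Ck_on_square k (partial_y f)"
      using Ck_on_square_cong[of fx "partial_x f"] Ck_on_square_cong[of fy "partial_y f"]
        Suc.IH[OF *(1)] Suc.IH[OF *(2)] partial_eq[OF *(3)] by auto
    moreover have "(\<lambda>s. f (s, y)) differentiable (at x within {-1..1})"
      "(\<lambda>s. f (x, s)) differentiable (at y within {-1..1})" for x y
      using *(3) unfolding has_partials_def
      by (meson differentiable_at_withinI real_differentiable_def)+
    ultimately show ?case
      using Suc.prems by (simp add: plane_smooth_continuous)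
  qed
  then show ?thesis using assms by (simp add: smooth_on_square_def)
qed

lemma plane_smooth_bounded:
  assumes "f \<in> plane_smooth"
  obtains M where "0 < M" "\<And>x y. \<bar>x\<bar> \<le> 1 \<Longrightarrow> \<bar>y\<bar> \<le> 1 \<Longrightarrow> \<bar>f (x, y)\<bar> \<le> M"
proof -
  have "compact (f ` square)"
    using assms by (intro compact_continuous_image plane_smooth_continuous compact_Times) auto
  then obtain M where "\<forall>v\<in>f ` square. norm v \<le> M" "0 < M"
    using compact_imp_bounded bounded_pos by blast
  then show thesis by (intro that[of M]) (auto simp: abs_le_iff)
qed

section \<open>Exponentials of saddle functions\<close>

text \<open>
  Adding \<open>m / 2 * s\<^sup>2\<close> keeps \<open>f\<close> concave, hence below its tangents. This gives
  \<open>f t - f s \<le> f' s * d - m / 2 * d\<^sup>2\<close> with \<open>d = t - s\<close>, and the right-hand side is maximal at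
  \<open>d = f' s / m\<close>.
\<close>

lemma strongly_concave_gap_le_gradient_square:
  fixes f :: "real \<Rightarrow> real"
  assumes f': "\<And>s. s \<in> S \<Longrightarrow> (f has_real_derivative f' s) (at s)"
    and f'': "\<And>s. s \<in> S \<Longrightarrow> (f' has_real_derivative f'' s) (at s)"
    and concave: "\<And>s. s \<in> S \<Longrightarrow> f'' s \<le> - m"
    and "convex S" "0 < m" "s \<in> S" "t \<in> S"
  shows "f t - f s \<le> (f' s)\<^sup>2 / (2 * m)"
proof -
  have "(- f' s - m * s) * (t - s) \<le> (- f t - m / 2 * t\<^sup>2) - (- f s - m / 2 * s\<^sup>2)"
    by (rule f''_imp_f'[of S "\<lambda>r. - f r - m / 2 * r\<^sup>2" "\<lambda>r. - f' r - m * r" "\<lambda>r. - f'' r - m"])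
      (use assms in \<open>auto intro!: derivative_eq_intros simp: le_minus_iff[of m]\<close>)
  then have "f t - f s \<le> f' s * (t - s) - m / 2 * (t - s)\<^sup>2"
    by (simp add: power2_eq_square field_simps)
  then have "2 * m * (f t - f s) \<le> 2 * m * (f' s * (t - s) - m / 2 * (t - s)\<^sup>2)"
    using \<open>0 < m\<close> by simp
  also have "\<dots> = (f' s)\<^sup>2 - (f' s - m * (t - s))\<^sup>2"
    by (simp add: power2_eq_square field_simps)
  also have "\<dots> \<le> (f' s)\<^sup>2" by simp
  finally have "2 * m * (f t - f s) \<le> (f' s)\<^sup>2" .
  then show ?thesis using \<open>0 < m\<close> by (simp add: pos_le_divide_eq mult.commute)
qed

lemma exp_diff_le: "exp a - exp b \<le> exp a * (a - b)" for a b :: real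
  using exp_ge_add_one_self[of "b - a"] mult_left_mono[of "1 + (b - a)" "exp (b - a)" "exp a"]
  by (simp add: algebra_simps flip: exp_add)

text \<open>
  The second derivative of \<open>exp (K * Z)\<close> in \<open>x\<close> is \<open>K * exp (K * Z) * (K * Zx\<^sup>2 + Zxx)\<close>. A large
  \<open>K\<close> therefore produces strong convexity as soon as \<open>Zxx\<close> is positive wherever \<open>Zx\<close> is small.
  In the other variable each slice \<open>x = const\<close> is either strongly concave or has a
  gradient bounded away from \<open>0\<close>; in both cases the gap of \<open>Z\<close> to its maximum is controlled by
  \<open>Zy\<^sup>2\<close>, and passing to \<open>exp (K * Z)\<close> costs only a constant because \<open>Z\<close> is bounded.
\<close>

lemma exponential_of_saddle_is_convex_PL:
  assumes "Z \<in> plane_smooth" "Zxx \<in> plane_smooth"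
    and Zy: "has_partials Z Zx Zy" and Zyy: "has_partials Zy Zyx Zyy"
    and "0 < m" "0 < \<delta>"
    and x_dir: "\<And>x y. \<bar>x\<bar> \<le> 1 \<Longrightarrow> \<bar>y\<bar> \<le> 1 \<Longrightarrow> m \<le> Zxx (x, y) \<or> \<delta> \<le> \<bar>Zx (x, y)\<bar>"
    and y_dir: "\<And>x. \<bar>x\<bar> \<le> 1 \<Longrightarrow> (\<forall>y. \<bar>y\<bar> \<le> 1 \<longrightarrow> Zyy (x, y) \<le> - m) \<or> (\<forall>y. \<bar>y\<bar> \<le> 1 \<longrightarrow> \<delta> \<le> \<bar>Zy (x, y)\<bar>)"
  shows "\<exists>K>0. \<exists>C>0. \<forall>x y. \<bar>x\<bar> \<le> 1 \<longrightarrow> \<bar>y\<bar> \<le> 1 \<longrightarrow>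
    inverse C \<le> K * exp (K * Z (x, y)) * (K * (Zx (x, y))\<^sup>2 + Zxx (x, y)) \<and>
    (\<forall>y'. \<bar>y'\<bar> \<le> 1 \<longrightarrow> exp (K * Z (x, y')) - exp (K * Z (x, y)) \<le> C * (K * exp (K * Z (x, y)) * Zy (x, y))\<^sup>2)"
proof -
  obtain W where W: "0 < W" "\<And>x y. \<bar>x\<bar> \<le> 1 \<Longrightarrow> \<bar>y\<bar> \<le> 1 \<Longrightarrow> \<bar>Z (x, y)\<bar> \<le> W"
    using plane_smooth_bounded[OF \<open>Z \<in> plane_smooth\<close>] by blast
  obtain M where M: "0 < M" "\<And>x y. \<bar>x\<bar> \<le> 1 \<Longrightarrow> \<bar>y\<bar> \<le> 1 \<Longrightarrow> \<bar>Zxx (x, y)\<bar> \<le> M"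
    using plane_smooth_bounded[OF \<open>Zxx \<in> plane_smooth\<close>] by blast
  \<comment> \<open>Where \<open>Zxx\<close> may be as small as \<open>- M\<close>, the term \<open>K * Zx\<^sup>2 \<ge> K * \<delta>\<^sup>2\<close> restores the bound \<open>m\<close>.\<close>
  define K where "K = (M + m) / \<delta>\<^sup>2"
  define c where "c = 1 / (2 * m) + 2 * W / \<delta>\<^sup>2"
  define C1 where "C1 = inverse (K * exp (- (K * W)) * m)"
  define C2 where "C2 = c * exp (3 * (K * W)) / K"
  have pos: "0 < K" "0 < c" "0 < C1" "0 < C2"
    using assms W M by (simp_all add: K_def c_def C1_def C2_def add_pos_pos)
  have convex: "inverse (C1 + C2) \<le> K * exp (K * Z (x, y)) * (K * (Zx (x, y))\<^sup>2 + Zxx (x, y))"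
    if xy: "\<bar>x\<bar> \<le> 1" "\<bar>y\<bar> \<le> 1" for x y
  proof -
    have "m \<le> K * (Zx (x, y))\<^sup>2 + Zxx (x, y)"
      using x_dir[OF xy]
    proof
      assume "m \<le> Zxx (x, y)"
      then show ?thesis using pos by (simp add: add_increasing)
    next
      assume "\<delta> \<le> \<bar>Zx (x, y)\<bar>"
      then have "\<delta>\<^sup>2 \<le> (Zx (x, y))\<^sup>2"
        using \<open>0 < \<delta>\<close> by (metis abs_le_square_iff abs_of_pos)
      then have "K * \<delta>\<^sup>2 \<le> K * (Zx (x, y))\<^sup>2" using pos by simp
      moreover have "K * \<delta>\<^sup>2 = M + m" using \<open>0 < \<delta>\<close> by (simp add: K_def)
      ultimately show ?thesis using M(2)[OF xy] by linarith
    qed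
    moreover have "exp (- (K * W)) \<le> exp (K * Z (x, y))"
      using W(2)[OF xy] mult_left_mono[of "- W" "Z (x, y)" K] pos by (simp add: abs_le_iff)
    ultimately have "K * exp (- (K * W)) * m \<le> K * exp (K * Z (x, y)) * (K * (Zx (x, y))\<^sup>2 + Zxx (x, y))"
      using pos \<open>0 < m\<close> by (intro mult_mono) auto
    moreover have "inverse (C1 + C2) \<le> inverse C1" using pos by simp
    ultimately show ?thesis by (simp add: C1_def)
  qed
  have PL: "exp (K * Z (x, y')) - exp (K * Z (x, y)) \<le> (C1 + C2) * (K * exp (K * Z (x, y)) * Zy (x, y))\<^sup>2"
    if xy: "\<bar>x\<bar> \<le> 1" "\<bar>y\<bar> \<le> 1" "\<bar>y'\<bar> \<le> 1" for x y y'
  proof (cases "Z (x, y') \<le> Z (x, y)")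
    case True
    then have "exp (K * Z (x, y')) - exp (K * Z (x, y)) \<le> 0" using pos by simp
    also have "\<dots> \<le> (C1 + C2) * (K * exp (K * Z (x, y)) * Zy (x, y))\<^sup>2" using pos by simp
    finally show ?thesis .
  next
    case False
    have gap: "Z (x, y') - Z (x, y) \<le> c * (Zy (x, y))\<^sup>2"
      using y_dir[OF xy(1)]
    proof
      assume *: "\<forall>y. \<bar>y\<bar> \<le> 1 \<longrightarrow> Zyy (x, y) \<le> - m"
      have "Z (x, y') - Z (x, y) \<le> (Zy (x, y))\<^sup>2 / (2 * m)"
        by (rule strongly_concave_gap_le_gradient_square
              [of "{-1..1}" "\<lambda>s. Z (x, s)" "\<lambda>s. Zy (x, s)" "\<lambda>s. Zyy (x, s)"])
          (use Zy Zyy xy * \<open>0 < m\<close> in \<open>auto simp: has_partials_def abs_le_iff\<close>)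
      also have "\<dots> \<le> c * (Zy (x, y))\<^sup>2"
        using W(1) by (simp add: c_def distrib_right)
      finally show ?thesis .
    next
      assume "\<forall>y. \<bar>y\<bar> \<le> 1 \<longrightarrow> \<delta> \<le> \<bar>Zy (x, y)\<bar>"
      then have "\<delta>\<^sup>2 \<le> (Zy (x, y))\<^sup>2"
        using \<open>0 < \<delta>\<close> xy by (metis abs_le_square_iff abs_of_pos)
      then have "2 * W / \<delta>\<^sup>2 * \<delta>\<^sup>2 \<le> c * (Zy (x, y))\<^sup>2"
        using W(1) \<open>0 < m\<close> pos by (intro mult_mono) (auto simp: c_def)
      then show ?thesis
        using W(2)[OF xy(1,2)] W(2)[OF xy(1,3)] \<open>0 < \<delta>\<close> by (auto simp: abs_le_iff)
    qed
    have "exp (K * Z (x, y')) - exp (K * Z (x, y)) \<le> exp (K * Z (x, y')) * (K * Z (x, y') - K * Z (x, y))"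
      by (rule exp_diff_le)
    also have "\<dots> = exp (K * Z (x, y')) * (K * (Z (x, y') - Z (x, y)))"
      by (simp add: right_diff_distrib)
    also have "\<dots> \<le> exp (K * W) * (K * (c * (Zy (x, y))\<^sup>2))"
      using W(2)[OF xy(1,3)] gap pos False by (intro mult_mono) (auto simp: abs_le_iff)
    also have "\<dots> = C2 * (K\<^sup>2 * exp (- (2 * (K * W))) * (Zy (x, y))\<^sup>2)"
    proof -
      have "exp (3 * (K * W)) * exp (- (2 * (K * W))) = exp (K * W)" by (simp flip: exp_add)
      then show ?thesis using pos by (simp add: C2_def power2_eq_square field_simps)
    qed
    also have "\<dots> \<le> (C1 + C2) * (K * exp (K * Z (x, y)) * Zy (x, y))\<^sup>2"
    proof (rule mult_mono)
      have "exp (- (2 * (K * W))) = (exp (- (K * W)))\<^sup>2"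
        by (simp add: power2_eq_square flip: exp_add)
      moreover have "exp (- (K * W)) \<le> exp (K * Z (x, y))"
        using W(2)[OF xy(1,2)] mult_left_mono[of "- W" "Z (x, y)" K] pos by (simp add: abs_le_iff)
      ultimately have "exp (- (2 * (K * W))) \<le> (exp (K * Z (x, y)))\<^sup>2"
        by (simp add: power_mono)
      then show "K\<^sup>2 * exp (- (2 * (K * W))) * (Zy (x, y))\<^sup>2 \<le> (K * exp (K * Z (x, y)) * Zy (x, y))\<^sup>2"
        by (simp add: power_mult_distrib mult_left_mono mult_right_mono)
    qed (use pos in auto)
    finally show ?thesis .
  qed
  show ?thesis
    using pos by (intro exI[of _ K] exI[of _ "C1 + C2"] conjI allI impI convex PL) auto
qed

lemma exp_partials:
  assumes "has_partials Z Zx Zy" "has_partials Zx Zxx Zxy"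
  shows "has_partials (\<lambda>p. exp (K * Z p)) (\<lambda>p. K * exp (K * Z p) * Zx p) (\<lambda>p. K * exp (K * Z p) * Zy p)"
    and "((\<lambda>s. K * exp (K * Z (s, y)) * Zx (s, y)) has_real_derivative
           K * exp (K * Z (x, y)) * (K * (Zx (x, y))\<^sup>2 + Zxx (x, y))) (at x)"
  using assms unfolding has_partials_def
  by (auto intro!: derivative_eq_intros simp: power2_eq_square algebra_simps)

section \<open>Planar flows and closed orbits\<close>

lemma plane_smooth_lipschitz:
  assumes "f \<in> plane_smooth"
  obtains L where "0 < L"
    "\<And>x y x' y'. (x, y) \<in> square \<Longrightarrow> (x', y') \<in> square \<Longrightarrow>
       \<bar>f (x, y) - f (x', y')\<bar> \<le> L * (\<bar>x - x'\<bar> + \<bar>y - y'\<bar>)"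
proof -
  obtain fx fy where f: "fx \<in> plane_smooth" "fy \<in> plane_smooth" "has_partials f fx fy"
    using plane_smooth_has_partials assms by blast
  obtain A where A: "0 < A" "\<And>x y. \<bar>x\<bar> \<le> 1 \<Longrightarrow> \<bar>y\<bar> \<le> 1 \<Longrightarrow> \<bar>fx (x, y)\<bar> \<le> A"
    using plane_smooth_bounded[OF f(1)] by blast
  obtain B where B: "0 < B" "\<And>x y. \<bar>x\<bar> \<le> 1 \<Longrightarrow> \<bar>y\<bar> \<le> 1 \<Longrightarrow> \<bar>fy (x, y)\<bar> \<le> B"
    using plane_smooth_bounded[OF f(2)] by blast
  have "\<bar>f (x, y) - f (x', y')\<bar> \<le> (A + B) * (\<bar>x - x'\<bar> + \<bar>y - y'\<bar>)"
    if "(x, y) \<in> square" "(x', y') \<in> square" for x y x' y'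
  proof -
    have "norm (f (x, y) - f (x', y)) \<le> A * norm (x - x')"
      by (rule field_differentiable_bound[of "{-1..1}" "\<lambda>s. f (s, y)" "\<lambda>s. fx (s, y)"])
        (use that f(3) A in \<open>auto simp: has_partials_def abs_le_iff intro: has_field_derivative_at_within\<close>)
    moreover have "norm (f (x', y) - f (x', y')) \<le> B * norm (y - y')"
      by (rule field_differentiable_bound[of "{-1..1}" "\<lambda>s. f (x', s)" "\<lambda>s. fy (x', s)"])
        (use that f(3) B in \<open>auto simp: has_partials_def abs_le_iff intro: has_field_derivative_at_within\<close>)
    ultimately have "\<bar>f (x, y) - f (x', y')\<bar> \<le> A * \<bar>x - x'\<bar> + B * \<bar>y - y'\<bar>" by simp
    also have "\<dots> \<le> (A + B) * \<bar>x - x'\<bar> + (A + B) * \<bar>y - y'\<bar>"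
      using A B by (intro add_mono mult_right_mono) auto
    finally show ?thesis by (simp add: distrib_left)
  qed
  then show thesis using A B by (intro that[of "A + B"]) auto
qed

lemma gronwall_zero:
  fixes d :: "real \<Rightarrow> real"
  assumes deriv: "\<And>t. 0 \<le> t \<Longrightarrow> (d has_real_derivative d' t) (at t within {0..})"
    and bound: "\<And>t. 0 \<le> t \<Longrightarrow> d' t \<le> L * d t"
    and "d 0 = 0" "0 \<le> t"
  shows "d t \<le> 0"
proof -
  let ?e = "\<lambda>t. d t * exp (- L * t)"
  have e: "(?e has_real_derivative (d' s - L * d s) * exp (- L * s)) (at s within {0..})" if "0 \<le> s" for s
    using deriv[OF that] by (auto intro!: derivative_eq_intros simp: algebra_simps)
  have "?e t \<le> ?e 0"
  proof (rule DERIV_nonpos_imp_decreasing_open[OF \<open>0 \<le> t\<close>])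
    fix s assume "0 < s" "s < t"
    moreover have "at s within {0..} = at s"
      using \<open>0 < s\<close> by (intro at_within_interior) auto
    ultimately show "\<exists>y. (?e has_real_derivative y) (at s) \<and> y \<le> 0"
      using e[of s] bound[of s] by (intro exI[of _ "(d' s - L * d s) * exp (- L * s)"])
        (auto simp: mult_nonpos_nonneg)
  next
    have "continuous_on {0..} ?e"
      by (rule DERIV_continuous_on[of _ _ "\<lambda>s. (d' s - L * d s) * exp (- L * s)"]) (use e in auto)
    then show "continuous_on {0..t} ?e" by (rule continuous_on_subset) auto
  qed
  then show ?thesis using \<open>d 0 = 0\<close> by (simp add: mult_le_0_iff)
qed

text \<open>
  Any flow can thus be replaced by the one constructed below. The squared distance \<open>d\<close> of two flows
  satisfies \<open>d' \<le> L * d\<close> by the Lipschitz bounds, and starts at \<open>0\<close>.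
\<close>

lemma flow_unique:
  fixes z w :: "real \<Rightarrow> real \<times> real"
  assumes "P \<in> plane_smooth" "Q \<in> plane_smooth"
    and z: "\<And>t. 0 \<le> t \<Longrightarrow> z t \<in> square \<and> (z has_vector_derivative (P (z t), Q (z t))) (at t within {0..})"
    and w: "\<And>t. 0 \<le> t \<Longrightarrow> w t \<in> square \<and> (w has_vector_derivative (P (w t), Q (w t))) (at t within {0..})"
    and "z 0 = w 0" "0 \<le> t"
  shows "z t = w t"
proof -
  obtain A where A: "0 < A" "\<And>x y x' y'. (x, y) \<in> square \<Longrightarrow> (x', y') \<in> square \<Longrightarrow>
       \<bar>P (x, y) - P (x', y')\<bar> \<le> A * (\<bar>x - x'\<bar> + \<bar>y - y'\<bar>)"
    using plane_smooth_lipschitz[OF assms(1)] by blast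
  obtain B where B: "0 < B" "\<And>x y x' y'. (x, y) \<in> square \<Longrightarrow> (x', y') \<in> square \<Longrightarrow>
       \<bar>Q (x, y) - Q (x', y')\<bar> \<le> B * (\<bar>x - x'\<bar> + \<bar>y - y'\<bar>)"
    using plane_smooth_lipschitz[OF assms(2)] by blast
  define a where "a t = fst (z t) - fst (w t)" for t
  define b where "b t = snd (z t) - snd (w t)" for t
  define p where "p t = P (z t) - P (w t)" for t
  define q where "q t = Q (z t) - Q (w t)" for t
  have a: "(a has_real_derivative p t) (at t within {0..})" if "0 \<le> t" for t
    using z[OF that] w[OF that] unfolding a_def p_def has_real_derivative_iff_has_vector_derivative
    by (intro has_vector_derivative_diff)
      (auto dest!: bounded_linear.has_vector_derivative[OF bounded_linear_fst])
  have b: "(b has_real_derivative q t) (at t within {0..})" if "0 \<le> t" for t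
    using z[OF that] w[OF that] unfolding b_def q_def has_real_derivative_iff_has_vector_derivative
    by (intro has_vector_derivative_diff)
      (auto dest!: bounded_linear.has_vector_derivative[OF bounded_linear_snd])
  have "(a t)\<^sup>2 + (b t)\<^sup>2 \<le> 0"
  proof (rule gronwall_zero[of "\<lambda>t. (a t)\<^sup>2 + (b t)\<^sup>2" "\<lambda>t. 2 * a t * p t + 2 * b t * q t" "4 * (A + B)"])
    fix t :: real assume t: "0 \<le> t"
    show "((\<lambda>t. (a t)\<^sup>2 + (b t)\<^sup>2) has_real_derivative 2 * a t * p t + 2 * b t * q t) (at t within {0..})"
      using a[OF t] b[OF t] by (auto intro!: derivative_eq_intros)
    let ?n = "\<bar>a t\<bar> + \<bar>b t\<bar>"
    have p: "\<bar>p t\<bar> \<le> A * ?n"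
      using A(2)[of "fst (z t)" "snd (z t)" "fst (w t)" "snd (w t)"] z[OF t] w[OF t]
      by (simp add: a_def b_def p_def)
    have q: "\<bar>q t\<bar> \<le> B * ?n"
      using B(2)[of "fst (z t)" "snd (z t)" "fst (w t)" "snd (w t)"] z[OF t] w[OF t]
      by (simp add: a_def b_def q_def)
    have "a t * p t \<le> \<bar>a t\<bar> * \<bar>p t\<bar>" by (simp flip: abs_mult)
    also have "\<dots> \<le> ?n * (A * ?n)" using p by (intro mult_mono) auto
    finally have ap: "a t * p t \<le> ?n * (A * ?n)" .
    have "b t * q t \<le> \<bar>b t\<bar> * \<bar>q t\<bar>" by (simp flip: abs_mult)
    also have "\<dots> \<le> ?n * (B * ?n)" using q by (intro mult_mono) auto
    finally have bq: "b t * q t \<le> ?n * (B * ?n)" .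
    have "?n\<^sup>2 \<le> 2 * ((a t)\<^sup>2 + (b t)\<^sup>2)"
      using sum_squares_bound[of "\<bar>a t\<bar>" "\<bar>b t\<bar>"] by (simp add: power2_sum)
    then have "2 * (A + B) * ?n\<^sup>2 \<le> 2 * (A + B) * (2 * ((a t)\<^sup>2 + (b t)\<^sup>2))"
      using A B by (intro mult_left_mono) auto
    then show "2 * a t * p t + 2 * b t * q t \<le> 4 * (A + B) * ((a t)\<^sup>2 + (b t)\<^sup>2)"
      using ap bq by (simp add: power2_eq_square algebra_simps)
  qed (use \<open>z 0 = w 0\<close> \<open>0 \<le> t\<close> in \<open>auto simp: a_def b_def\<close>)
  then have "a t = 0" "b t = 0" by (auto simp: sum_power2_le_zero_iff)
  then show ?thesis by (simp add: a_def b_def prod_eq_iff)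
qed

lemma ex_antiderivative:
  fixes f :: "real \<Rightarrow> real"
  assumes "continuous_on UNIV f"
  shows "\<exists>F. \<forall>x. (F has_real_derivative f x) (at x)"
proof -
  have "\<exists>F. \<forall>x. -\<infinity> < ereal x \<longrightarrow> ereal x < \<infinity> \<longrightarrow> (F has_vector_derivative f x) (at x)"
    by (rule einterval_antiderivative) (use assms in \<open>auto simp: continuous_on_eq_continuous_at\<close>)
  then show ?thesis
    by (auto simp: has_real_derivative_iff_has_vector_derivative)
qed

lemma antiderivative_of_periodic:
  fixes F f :: "real \<Rightarrow> real"
  assumes F: "\<And>x. (F has_real_derivative f x) (at x)" and per: "\<And>x. f (x + p) = f x"
  shows "F (x + p) = F x + (F p - F 0)"
proof -
  have "((\<lambda>x. F (x + p) - F x) has_real_derivative 0) (at x)" for x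
    using F[of x] DERIV_shift[of F "f (x + p)" x p] F[of "x + p"] per
    by (auto intro!: derivative_eq_intros)
  then have "F (x + p) - F x = F (0 + p) - F 0"
    by (intro DERIV_isconst_all[of "\<lambda>x. F (x + p) - F x" x 0]) simp
  then show ?thesis by simp
qed

text \<open>
  A closed curve along the direction field of \<open>V\<close>, traversed at the wrong speed, becomes a flow of \<open>V\<close>
  once the time \<open>\<tau>\<close> needed to reach each parameter is inverted. One turn takes the same time
  \<open>T\<close> from everywhere, as the speed is periodic; this gives both the surjectivity of \<open>\<tau>\<close> and the
  periodicity of the flow.
\<close>

lemma closed_orbit_reparametrization:
  fixes \<gamma> :: "real \<Rightarrow> 'a::real_normed_vector"
  assumes \<gamma>: "\<And>\<theta>. (\<gamma> has_vector_derivative (1 / \<omega> \<theta>) *\<^sub>R V (\<gamma> \<theta>)) (at \<theta>)"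
    and \<omega>: "\<And>\<theta>. 0 < \<omega> \<theta>" "continuous_on UNIV \<omega>"
    and per: "\<And>\<theta>. \<gamma> (\<theta> + p) = \<gamma> \<theta>" "\<And>\<theta>. \<omega> (\<theta> + p) = \<omega> \<theta>" and "0 < p"
  shows "\<exists>z. \<exists>T>0. z 0 = \<gamma> \<theta>\<^sub>0 \<and>
    (\<forall>t. z (t + T) = z t \<and> z t \<in> range \<gamma> \<and> (z has_vector_derivative V (z t)) (at t))"
proof -
  have "continuous_on UNIV (\<lambda>\<theta>. 1 / \<omega> \<theta>)"
    using \<omega> by (intro continuous_intros) (auto simp: less_imp_neq[symmetric])
  then obtain \<tau> where \<tau>: "\<And>\<theta>. (\<tau> has_real_derivative 1 / \<omega> \<theta>) (at \<theta>)"
    using ex_antiderivative by blast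
  have mono: "\<tau> a < \<tau> b" if "a < b" for a b
    using \<tau> \<omega>(1) by (intro DERIV_pos_imp_increasing[OF that]) (auto intro!: exI)
  define T where "T = \<tau> p - \<tau> 0"
  have "0 < T" using mono[OF \<open>0 < p\<close>] by (simp add: T_def)
  have shift: "\<tau> (\<theta> + p) = \<tau> \<theta> + T" for \<theta>
    using antiderivative_of_periodic[OF \<tau>, of p] per by (simp add: T_def)
  have shift_n: "\<tau> (\<theta> + real n * p) = \<tau> \<theta> + real n * T" for \<theta> n
  proof (induction n)
    case (Suc n)
    have "\<theta> + real (Suc n) * p = (\<theta> + real n * p) + p" by (simp add: algebra_simps)
    then show ?case using Suc by (simp only: shift) (simp add: algebra_simps)
  qed simp
  have isCont: "isCont \<tau> \<theta>" for \<theta> using \<tau> DERIV_isCont by blast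
  have "\<exists>\<theta>. \<tau> \<theta> = t" for t
  proof -
    obtain n :: nat where n: "\<bar>t - \<tau> 0\<bar> < real n * T"
      using reals_Archimedean3[OF \<open>0 < T\<close>] by blast
    have "\<tau> (- (real n * p)) + real n * T = \<tau> 0"
      using shift_n[of "- (real n * p)" n] by simp
    then have "\<tau> (- (real n * p)) \<le> t" "t \<le> \<tau> (real n * p)"
      using n shift_n[of 0 n] by auto
    moreover have "- (real n * p) \<le> real n * p" using \<open>0 < p\<close> by simp
    ultimately show ?thesis
      using IVT[of \<tau> "- (real n * p)" t "real n * p"] isCont by blast
  qed
  then obtain \<Theta> where \<Theta>: "\<And>t. \<tau> (\<Theta> t) = t" by metis
  have inj: "a = b" if "\<tau> a = \<tau> b" for a b
    using mono[of a b] mono[of b a] that by (cases a b rule: linorder_cases) auto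
  have "isCont \<Theta> (\<tau> \<theta>)" for \<theta>
    by (rule isCont_inverse_function[where d = 1 and x = \<theta> and f = \<tau> and g = \<Theta>]) (use isCont \<Theta> inj in auto)
  then have "isCont \<Theta> t" for t using \<Theta> by metis
  then have "(\<Theta> has_real_derivative inverse (1 / \<omega> (\<Theta> t))) (at t)" for t
    using \<Theta> \<omega>(1)[of "\<Theta> t"]
    by (intro DERIV_inverse_function[where f = \<tau> and a = "t - 1" and b = "t + 1"] \<tau>) auto
  then have \<Theta>': "(\<Theta> has_vector_derivative \<omega> (\<Theta> t)) (at t)" for t
    by (simp add: has_real_derivative_iff_has_vector_derivative)
  let ?z = "\<lambda>t. \<gamma> (\<Theta> (t + \<tau> \<theta>\<^sub>0))"
  show ?thesis
  proof (intro exI[of _ ?z] exI[of _ T] conjI allI)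
    show "?z 0 = \<gamma> \<theta>\<^sub>0" using inj[of "\<Theta> (\<tau> \<theta>\<^sub>0)" \<theta>\<^sub>0] \<Theta> by simp
    show "?z (t + T) = ?z t" for t
    proof -
      have "\<Theta> (t + T + \<tau> \<theta>\<^sub>0) = \<Theta> (t + \<tau> \<theta>\<^sub>0) + p"
        by (rule inj) (simp add: \<Theta> shift)
      then show ?thesis by (simp add: per)
    qed
    show "(?z has_vector_derivative V (?z t)) (at t)" for t
    proof -
      have 1: "((\<lambda>t. t + \<tau> \<theta>\<^sub>0) has_vector_derivative 1) (at t)"
        by (auto intro!: derivative_eq_intros)
      have "((\<gamma> \<circ> (\<Theta> \<circ> (\<lambda>t. t + \<tau> \<theta>\<^sub>0))) has_vector_derivative
         (1 *\<^sub>R \<omega> (\<Theta> (t + \<tau> \<theta>\<^sub>0))) *\<^sub>R (1 / \<omega> (\<Theta> (t + \<tau> \<theta>\<^sub>0))) *\<^sub>R V (?z t)) (at t)"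
        using \<gamma> by (intro vector_diff_chain_at 1 \<Theta>') auto
      then show ?thesis using \<omega>(1)[of "\<Theta> (t + \<tau> \<theta>\<^sub>0)"] by (simp add: o_def)
    qed
  qed (use \<open>0 < T\<close> in auto)
qed

section \<open>Closing the orbits of a homogeneous saddle\<close>

text \<open>
  Away from the origin, the saddle function \<open>Z\<close> constructed below is homogeneous of degree 2, so that
  its descent-ascent field at the point with polar coordinates \<open>(r, \<theta>)\<close> is \<open>r\<close> times a vector that depends on
  \<open>\<theta>\<close> only. The angular component of that vector is \<open>turning_rate \<epsilon> \<theta>\<close>, and its radial
  component is \<open>2 * \<epsilon> * (lobe \<theta> - \<tau>)\<close>.
\<close>

definition turning_rate :: "real \<Rightarrow> real \<Rightarrow> real" where
  "turning_rate \<epsilon> \<theta> = 1 - 4 * \<epsilon> * sin (2 * \<theta>) * cos (2 * \<theta>) ^ 3"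

definition lobe :: "real \<Rightarrow> real" where
  "lobe \<theta> = (sin (2 * \<theta>))\<^sup>2 * (2 * (sin (2 * \<theta>))\<^sup>2 - 1)"

lemma turning_rate_periodic: "turning_rate \<epsilon> (\<theta> + 2 * pi) = turning_rate \<epsilon> \<theta>"
  and lobe_periodic: "lobe (\<theta> + 2 * pi) = lobe \<theta>"
proof -
  have "2 * (\<theta> + 2 * pi) = (2 * \<theta> + 2 * pi) + 2 * pi" by simp
  then have "sin (2 * (\<theta> + 2 * pi)) = sin (2 * \<theta>)" "cos (2 * (\<theta> + 2 * pi)) = cos (2 * \<theta>)"
    by (simp_all only: sin_periodic cos_periodic)
  then show "turning_rate \<epsilon> (\<theta> + 2 * pi) = turning_rate \<epsilon> \<theta>" "lobe (\<theta> + 2 * pi) = lobe \<theta>"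
    by (simp_all add: turning_rate_def lobe_def)
qed

lemma abs_lobe_le: "\<bar>lobe \<theta>\<bar> \<le> 1"
proof -
  have "(sin (2 * \<theta>))\<^sup>2 \<le> 1" by (simp add: abs_square_le_1)
  then have "\<bar>(sin (2 * \<theta>))\<^sup>2\<bar> * \<bar>2 * (sin (2 * \<theta>))\<^sup>2 - 1\<bar> \<le> 1 * 1"
    by (intro mult_mono) (auto simp: abs_le_iff)
  then show ?thesis by (simp add: lobe_def abs_mult)
qed

lemma abs_turning_rate:
  assumes "0 \<le> \<epsilon>" shows "\<bar>turning_rate \<epsilon> \<theta> - 1\<bar> \<le> 4 * \<epsilon>"
proof -
  have "\<bar>sin (2 * \<theta>)\<bar> * \<bar>cos (2 * \<theta>)\<bar> ^ 3 \<le> 1 * 1 ^ 3"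
    by (intro mult_mono power_mono) auto
  then have "4 * \<epsilon> * (\<bar>sin (2 * \<theta>)\<bar> * \<bar>cos (2 * \<theta>)\<bar> ^ 3) \<le> 4 * \<epsilon> * 1"
    using assms by (intro mult_left_mono) auto
  then show ?thesis using assms by (simp add: turning_rate_def abs_mult power_abs)
qed

text \<open>
  The constant term \<open>1 / 4\<close>, the mean of \<open>lobe\<close>, is what makes the closing coefficient
  positive.
\<close>

lemma lobe_fourier: "lobe \<theta> = 1 / 4 - cos (4 * \<theta>) / 2 + cos (8 * \<theta>) / 4"
proof -
  have c4: "cos (4 * \<theta>) = 1 - 2 * (sin (2 * \<theta>))\<^sup>2"
    using cos_double_sin[of "2 * \<theta>"] by simp
  have "cos (8 * \<theta>) = 2 * (cos (4 * \<theta>))\<^sup>2 - 1"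
    using cos_double_cos[of "4 * \<theta>"] by simp
  then show ?thesis unfolding lobe_def c4 by (simp add: power2_eq_square field_simps)
qed

text \<open>
  Along an orbit, \<open>R = ln r\<close> satisfies \<open>dR / d\<theta> = 2 * \<epsilon> * (lobe \<theta> - \<tau>) / turning_rate \<epsilon> \<theta>\<close>, and the orbit closes
  if and only if the integral over a full turn vanishes. The denominator does not involve \<open>\<tau>\<close>, so this is
  a linear equation for \<open>\<tau>\<close>: the solution is the average of \<open>lobe\<close> with respect to the weight
  \<open>1 / turning_rate \<epsilon>\<close>. For small \<open>\<epsilon>\<close> the weight is almost constant, hence \<open>\<tau>\<close> is close to the
  mean \<open>1 / 4\<close> of \<open>lobe\<close>. That \<open>\<tau>\<close> stays away from \<open>0\<close> is what allows convexity in \<open>x\<close> and concavity in \<open>y\<close>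
  at the axes.
\<close>

lemma closing_coefficient_exists:
  assumes \<epsilon>: "0 < \<epsilon>" "\<epsilon> \<le> 1 / 1000"
  obtains \<tau> R where "1 / 8 \<le> \<tau>" "\<tau> \<le> 1"
    "\<And>\<theta>. (R has_real_derivative 2 * \<epsilon> * (lobe \<theta> - \<tau>) / turning_rate \<epsilon> \<theta>) (at \<theta>)"
    "\<And>\<theta>. R (\<theta> + 2 * pi) = R \<theta>"
proof -
  let ?B = "turning_rate \<epsilon>"
  have B: "\<bar>?B \<theta> - 1\<bar> \<le> 1 / 250" for \<theta>
    using abs_turning_rate[of \<epsilon> \<theta>] \<epsilon> by linarith
  then have B_pos: "1 / 2 \<le> ?B \<theta>" for \<theta> using B[of \<theta>] by linarith
  then have B_nz: "?B \<theta> \<noteq> 0" for \<theta> using B_pos[of \<theta>] by linarith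
  have cont: "continuous_on UNIV ?B" "continuous_on UNIV lobe"
    unfolding turning_rate_def lobe_def by (intro continuous_intros)+
  have "continuous_on UNIV (\<lambda>\<theta>. 1 / ?B \<theta>)" "continuous_on UNIV (\<lambda>\<theta>. lobe \<theta> / ?B \<theta>)"
    using cont B_nz by (auto intro!: continuous_intros)
  from this[THEN ex_antiderivative] obtain P Q
    where P: "\<And>\<theta>. (P has_real_derivative 1 / ?B \<theta>) (at \<theta>)"
      and Q: "\<And>\<theta>. (Q has_real_derivative lobe \<theta> / ?B \<theta>) (at \<theta>)"
    by auto
  define \<tau> where "\<tau> = (Q (2 * pi) - Q 0) / (P (2 * pi) - P 0)"
  define R where "R \<theta> = 2 * \<epsilon> * (Q \<theta> - \<tau> * P \<theta>)" for \<theta>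
  have "P 0 < P (2 * pi)"
  proof (rule DERIV_pos_imp_increasing[of 0 "2 * pi" P])
    fix \<theta>
    have "0 < 1 / ?B \<theta>" using B_pos[of \<theta>] by simp
    then show "\<exists>y. (P has_real_derivative y) (at \<theta>) \<and> 0 < y" using P by blast
  qed simp
  then have P_pos: "0 < P (2 * pi) - P 0" by simp
  have "(\<lambda>\<theta>. P \<theta> - Q \<theta>) 0 \<le> (\<lambda>\<theta>. P \<theta> - Q \<theta>) (2 * pi)"
  proof (rule DERIV_nonneg_imp_nondecreasing[of 0 "2 * pi" "\<lambda>\<theta>. P \<theta> - Q \<theta>"])
    fix \<theta>
    have "((\<lambda>\<theta>. P \<theta> - Q \<theta>) has_real_derivative 1 / ?B \<theta> - lobe \<theta> / ?B \<theta>) (at \<theta>)"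
      by (intro derivative_intros P Q)
    moreover have "lobe \<theta> / ?B \<theta> \<le> 1 / ?B \<theta>"
      using abs_lobe_le[of \<theta>] B_pos[of \<theta>] by (intro divide_right_mono) auto
    ultimately show "\<exists>y. ((\<lambda>\<theta>. P \<theta> - Q \<theta>) has_real_derivative y) (at \<theta>) \<and> 0 \<le> y" by force
  qed simp
  then have "\<tau> \<le> 1" using P_pos by (simp add: \<tau>_def divide_le_eq)
  \<comment> \<open>The bracket is an antiderivative of \<open>lobe \<theta> - 1 / 8\<close> and stands for the constant weight; the
    last summand absorbs the error made by replacing \<open>1 / turning_rate \<epsilon>\<close> with \<open>1\<close>.\<close>
  let ?D = "\<lambda>\<theta>. Q \<theta> - P \<theta> / 8 - (\<theta> / 8 - sin (4 * \<theta>) / 8 + sin (8 * \<theta>) / 32) + \<theta> / 16"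
  have "?D 0 \<le> ?D (2 * pi)"
  proof (rule DERIV_nonneg_imp_nondecreasing[of 0 "2 * pi" ?D])
    fix \<theta>
    have D': "(?D has_real_derivative
        lobe \<theta> / ?B \<theta> - 1 / ?B \<theta> / 8 - (1 / 8 - cos (4 * \<theta>) / 2 + cos (8 * \<theta>) / 4) + 1 / 16) (at \<theta>)"
      by (rule derivative_eq_intros P Q refl | simp)+
    have D'_eq: "lobe \<theta> / ?B \<theta> - 1 / ?B \<theta> / 8 - (1 / 8 - cos (4 * \<theta>) / 2 + cos (8 * \<theta>) / 4)
        = (lobe \<theta> - 1 / 8) * ((1 - ?B \<theta>) / ?B \<theta>)"
    proof -
      have "1 / 8 - cos (4 * \<theta>) / 2 + cos (8 * \<theta>) / 4 = lobe \<theta> - 1 / 8"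
        using lobe_fourier[of \<theta>] by simp
      then show ?thesis using B_nz[of \<theta>] by (simp only:) (simp add: field_simps)
    qed
    have "\<bar>(lobe \<theta> - 1 / 8) * ((1 - ?B \<theta>) / ?B \<theta>)\<bar> \<le> 2 * ((1 / 250) / (1 / 2))"
      unfolding abs_mult abs_divide
      using abs_lobe_le[of \<theta>] B_pos[of \<theta>] B[of \<theta>] abs_minus_commute[of 1 "?B \<theta>"]
      by (intro mult_mono frac_le) auto
    moreover have "\<bar>e\<bar> \<le> 2 * ((1 / 250) / (1 / 2)) \<Longrightarrow> 0 \<le> e + 1 / 16" for e :: real
      by (simp add: abs_le_iff)
    ultimately have "0 \<le> (lobe \<theta> - 1 / 8) * ((1 - ?B \<theta>) / ?B \<theta>) + 1 / 16" by blast
    then show "\<exists>y. (?D has_real_derivative y) (at \<theta>) \<and> 0 \<le> y"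
      using D' unfolding D'_eq by blast
  qed simp
  moreover have "sin (4 * (2 * pi)) = 0" "sin (8 * (2 * pi)) = 0"
    using sin_npi[of 8] sin_npi[of 16] by simp_all
  ultimately have "Q 0 - P 0 / 8 \<le> Q (2 * pi) - P (2 * pi) / 8 - pi / 8" by simp
  then have "0 \<le> (Q (2 * pi) - Q 0) - (P (2 * pi) - P 0) / 8"
    using pi_gt_zero by (simp only: diff_divide_distrib)
  then have "1 / 8 \<le> \<tau>" using P_pos by (simp add: \<tau>_def le_divide_eq)
  have R: "(R has_real_derivative 2 * \<epsilon> * (lobe \<theta> - \<tau>) / ?B \<theta>) (at \<theta>)" for \<theta>
    unfolding R_def
    by (rule derivative_eq_intros P Q refl)+ (simp add: diff_divide_distrib algebra_simps)
  have "R (2 * pi) - R 0 = 2 * \<epsilon> * ((Q (2 * pi) - Q 0) - \<tau> * (P (2 * pi) - P 0))"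
    by (simp add: R_def algebra_simps)
  also have "\<dots> = 0" using P_pos by (simp add: \<tau>_def)
  finally have "R (\<theta> + 2 * pi) = R \<theta>" for \<theta>
    using antiderivative_of_periodic[OF R, of "2 * pi" \<theta>] turning_rate_periodic lobe_periodic by simp
  then show thesis using that[of \<tau> R] R \<open>\<tau> \<le> 1\<close> \<open>1 / 8 \<le> \<tau>\<close> by blast
qed

text \<open>
  The mean value theorem, after moving \<open>\<alpha>\<close> by a multiple of \<open>p\<close> into the period that ends at \<open>\<beta>\<close>.
\<close>

lemma periodic_oscillation_le:
  fixes R R' :: "real \<Rightarrow> real"
  assumes R: "\<And>\<theta>. (R has_real_derivative R' \<theta>) (at \<theta>)" and R': "\<And>\<theta>. \<bar>R' \<theta>\<bar> \<le> b"
    and per: "\<And>\<theta>. R (\<theta> + p) = R \<theta>" and "0 < p"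
  shows "\<bar>R \<alpha> - R \<beta>\<bar> \<le> b * p"
proof -
  have shift_nat: "R (\<theta> + real n * p) = R \<theta>" for \<theta> n
  proof (induction n)
    case (Suc n)
    have "\<theta> + real (Suc n) * p = (\<theta> + real n * p) + p" by (simp add: algebra_simps)
    then show ?case using Suc by (simp only: per)
  qed simp
  have shift: "R (\<theta> + of_int n * p) = R \<theta>" for \<theta> n
  proof (cases "0 \<le> n")
    case True
    then show ?thesis using shift_nat[of \<theta> "nat n"] by simp
  next
    case False
    then show ?thesis using shift_nat[of "\<theta> + of_int n * p" "nat (- n)"] by simp
  qed
  define n where "n = \<lfloor>(\<beta> - \<alpha>) / p\<rfloor>"
  have "of_int n \<le> (\<beta> - \<alpha>) / p" "(\<beta> - \<alpha>) / p < of_int n + 1" unfolding n_def by linarith+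
  then have n: "of_int n * p \<le> \<beta> - \<alpha>" "\<beta> - \<alpha> < (of_int n + 1) * p"
    using \<open>0 < p\<close> by (simp_all add: le_divide_eq divide_less_eq)
  have "0 \<le> b" using R'[of 0] by linarith
  have "norm (R (\<alpha> + of_int n * p) - R \<beta>) \<le> b * norm ((\<alpha> + of_int n * p) - \<beta>)"
    by (rule field_differentiable_bound[of UNIV R R']) (use R R' in auto)
  also have "\<dots> \<le> b * p"
    using n \<open>0 \<le> b\<close> by (intro mult_left_mono) (auto simp: algebra_simps)
  finally show ?thesis by (simp add: shift)
qed

section \<open>The saddle function\<close>

text \<open>
  A smooth function on the whole plane which is \<open>1 / r ^ 4\<close> outside the disc of radius \<open>1 / 4\<close>:
  inside the disc the summand \<open>flat\<close> keeps the denominator positive, and it vanishes outside.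
\<close>

definition core_mollifier :: "real \<times> real \<Rightarrow> real" where
  "core_mollifier p = inverse (((fst p)\<^sup>2 + (snd p)\<^sup>2)\<^sup>2 + flat 0 (1 / 16 - ((fst p)\<^sup>2 + (snd p)\<^sup>2)))"

lemma DERIV_divide_square:
  fixes n q :: "real \<Rightarrow> real"
  assumes "(n has_real_derivative n') (at x)" "(q has_real_derivative q') (at x)" "q x \<noteq> 0"
  shows "((\<lambda>s. n s / (q s)\<^sup>2) has_real_derivative n' / (q x)\<^sup>2 - 2 * q' * n x / q x ^ 3) (at x)"
proof -
  have "((\<lambda>s. n s / (q s)\<^sup>2) has_real_derivative
      (n' * (q x)\<^sup>2 - n x * (2 * q x * q')) / ((q x)\<^sup>2 * (q x)\<^sup>2)) (at x)"
    using assms by (auto intro!: derivative_eq_intros)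
  moreover have "n' * (q x)\<^sup>2 / ((q x)\<^sup>2 * (q x)\<^sup>2) = n' / (q x)\<^sup>2"
    using assms(3) by (intro nonzero_mult_divide_mult_cancel_right) simp
  moreover have "n x * (2 * q x * q') / ((q x)\<^sup>2 * (q x)\<^sup>2) = 2 * q' * n x / q x ^ 3"
    using assms(3) by (simp add: power2_eq_square power3_eq_cube mult_ac)
  ultimately show ?thesis by (simp only: diff_divide_distrib)
qed

lemma core_mollifier_smooth: "core_mollifier \<in> plane_smooth"
proof -
  have "q\<^sup>2 + flat 0 (1 / 16 - q) \<noteq> 0" for q :: real
    using flat_pos[of "1 / 16 - q" 0] flat_eq_0[of "1 / 16 - q" 0]
    by (cases "q < 1 / 16") (auto simp: add_nonneg_pos less_imp_neq[symmetric])
  then show ?thesis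
    unfolding core_mollifier_def[abs_def] by (intro plane_smooth_intros)
qed

lemma core_mollifier_outside:
  "1 / 16 < x\<^sup>2 + y\<^sup>2 \<Longrightarrow> core_mollifier (x, y) = 1 / (x\<^sup>2 + y\<^sup>2)\<^sup>2"
  using flat_eq_0[of "1 / 16 - (x\<^sup>2 + y\<^sup>2)" 0]
  unfolding core_mollifier_def fst_conv snd_conv inverse_eq_divide by simp

text \<open>
  The term \<open>4 * (x\<^sup>2 - y\<^sup>2) * x\<^sup>2 * y\<^sup>2 * core_mollifier (x, y)\<close> of the saddle below is \<open>y\<^sup>2 * g = x\<^sup>2 * h\<close>, with \<open>g\<close> and
  \<open>h\<close> the two functions whose derivatives are fixed here. Its \<open>x\<close>-derivatives thus carry a factor \<open>y\<^sup>2\<close> and its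
  \<open>y\<close>-derivatives a factor \<open>x\<^sup>2\<close>; besides these factors, only the uniform bound \<open>M\<close> and the
  values outside the core matter.
\<close>

locale spinning_saddle =
  fixes gx gxx gxy hy hyx hyy :: "real \<times> real \<Rightarrow> real" and gy hx :: "real \<times> real \<Rightarrow> real" and M :: real
  assumes g: "has_partials (\<lambda>p. 4 * ((fst p)\<^sup>2 - (snd p)\<^sup>2) * (fst p)\<^sup>2 * core_mollifier p) gx gy"
    and gx: "has_partials gx gxx gxy"
    and h: "has_partials (\<lambda>p. 4 * ((fst p)\<^sup>2 - (snd p)\<^sup>2) * (snd p)\<^sup>2 * core_mollifier p) hx hy"
    and hy: "has_partials hy hyx hyy"
    and smooth: "gx \<in> plane_smooth" "gxx \<in> plane_smooth" "hy \<in> plane_smooth"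
    and M: "1 \<le> M" "\<And>x y. \<bar>x\<bar> \<le> 1 \<Longrightarrow> \<bar>y\<bar> \<le> 1 \<Longrightarrow>
      \<bar>gx (x, y)\<bar> \<le> M \<and> \<bar>gxx (x, y)\<bar> \<le> M \<and> \<bar>hy (x, y)\<bar> \<le> M \<and> \<bar>hyy (x, y)\<bar> \<le> M"
begin

text \<open>
  The flow of \<open>x * y\<close> is the rotation about the origin. The term \<open>\<epsilon> * \<tau> * (x\<^sup>2 - y\<^sup>2)\<close> makes the saddle strictly convex in \<open>x\<close> and
  strictly concave in \<open>y\<close>, at the price of a contraction. The last term compensates this contraction in the
  open quadrants, where the slopes of \<open>x * y\<close> do not vanish and the sign of the curvature is irrelevant.
\<close>

definition Z :: "real \<Rightarrow> real \<Rightarrow> real \<times> real \<Rightarrow> real" where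
  "Z \<epsilon> \<tau> p = fst p * snd p + \<epsilon> * ((fst p)\<^sup>2 - (snd p)\<^sup>2) * (\<tau> - 4 * (fst p)\<^sup>2 * (snd p)\<^sup>2 * core_mollifier p)"

definition Zx where
  "Zx \<epsilon> \<tau> p = snd p + \<epsilon> * (2 * \<tau> * fst p - (snd p)\<^sup>2 * gx p)"
definition Zxx where
  "Zxx \<epsilon> \<tau> p = \<epsilon> * (2 * \<tau> - (snd p)\<^sup>2 * gxx p)"
definition Zxy where
  "Zxy \<epsilon> p = 1 - \<epsilon> * (2 * snd p * gx p + (snd p)\<^sup>2 * gxy p)"
definition Zy where
  "Zy \<epsilon> \<tau> p = fst p - \<epsilon> * (2 * \<tau> * snd p + (fst p)\<^sup>2 * hy p)"
definition Zyx where
  "Zyx \<epsilon> p = 1 - \<epsilon> * (2 * fst p * hy p + (fst p)\<^sup>2 * hyx p)"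
definition Zyy where
  "Zyy \<epsilon> \<tau> p = - \<epsilon> * (2 * \<tau> + (fst p)\<^sup>2 * hyy p)"

lemma Z_partials: "has_partials (Z \<epsilon> \<tau>) (Zx \<epsilon> \<tau>) (Zy \<epsilon> \<tau>)"
  unfolding has_partials_def
proof (intro allI conjI)
  fix x y
  let ?g = "\<lambda>p. 4 * ((fst p)\<^sup>2 - (snd p)\<^sup>2) * (fst p)\<^sup>2 * core_mollifier p"
  have product_x: "((\<lambda>s. s * y + \<epsilon> * (\<tau> * (s\<^sup>2 - y\<^sup>2) - y\<^sup>2 * G s)) has_real_derivative
      y + \<epsilon> * (2 * \<tau> * x - y\<^sup>2 * G')) (at x)" if "(G has_real_derivative G') (at x)" for G G'
    using that by (auto intro!: derivative_eq_intros simp: algebra_simps)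
  have "((\<lambda>s. ?g (s, y)) has_real_derivative gx (x, y)) (at x)"
    using g by (simp only: has_partials_def)
  from product_x[OF this]
  have "((\<lambda>s. s * y + \<epsilon> * (\<tau> * (s\<^sup>2 - y\<^sup>2) - y\<^sup>2 * ?g (s, y))) has_real_derivative Zx \<epsilon> \<tau> (x, y)) (at x)"
    by (simp add: Zx_def)
  then show "((\<lambda>s. Z \<epsilon> \<tau> (s, y)) has_real_derivative Zx \<epsilon> \<tau> (x, y)) (at x)"
    by (simp add: Z_def algebra_simps)
  let ?h = "\<lambda>p. 4 * ((fst p)\<^sup>2 - (snd p)\<^sup>2) * (snd p)\<^sup>2 * core_mollifier p"
  have product_y: "((\<lambda>s. x * s + \<epsilon> * (\<tau> * (x\<^sup>2 - s\<^sup>2) - x\<^sup>2 * H s)) has_real_derivative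
      x - \<epsilon> * (2 * \<tau> * y + x\<^sup>2 * H')) (at y)" if "(H has_real_derivative H') (at y)" for H H'
    using that by (auto intro!: derivative_eq_intros simp: algebra_simps)
  have "((\<lambda>s. ?h (x, s)) has_real_derivative hy (x, y)) (at y)"
    using h by (simp only: has_partials_def)
  from product_y[OF this]
  have "((\<lambda>s. x * s + \<epsilon> * (\<tau> * (x\<^sup>2 - s\<^sup>2) - x\<^sup>2 * ?h (x, s))) has_real_derivative Zy \<epsilon> \<tau> (x, y)) (at y)"
    by (simp add: Zy_def)
  then show "((\<lambda>s. Z \<epsilon> \<tau> (x, s)) has_real_derivative Zy \<epsilon> \<tau> (x, y)) (at y)"
    by (simp add: Z_def algebra_simps)
qed

lemma Zx_partials: "has_partials (Zx \<epsilon> \<tau>) (Zxx \<epsilon> \<tau>) (Zxy \<epsilon>)"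
  using gx unfolding has_partials_def Zx_def Zxx_def Zxy_def
  by (auto intro!: derivative_eq_intros simp: algebra_simps)

lemma Zy_partials: "has_partials (Zy \<epsilon> \<tau>) (Zyx \<epsilon>) (Zyy \<epsilon> \<tau>)"
  using hy unfolding has_partials_def Zy_def Zyy_def Zyx_def
  by (auto intro!: derivative_eq_intros simp: algebra_simps)

text \<open>
  The functions \<open>gx\<close> and \<open>hy\<close> are known only as derivatives. Outside the core they are identified with the
  derivatives of the explicit homogeneous expression by uniqueness of derivatives.
\<close>

lemma gradient_outside_core:
  assumes out: "1 / 16 < x\<^sup>2 + y\<^sup>2"
  shows "y\<^sup>2 * gx (x, y) = (16 * x ^ 3 * y\<^sup>2 - 8 * x * y ^ 4) / (x\<^sup>2 + y\<^sup>2)\<^sup>2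
           - 16 * x ^ 3 * y\<^sup>2 * (x\<^sup>2 - y\<^sup>2) / (x\<^sup>2 + y\<^sup>2) ^ 3"
    and "x\<^sup>2 * hy (x, y) = (8 * x ^ 4 * y - 16 * x\<^sup>2 * y ^ 3) / (x\<^sup>2 + y\<^sup>2)\<^sup>2
           - 16 * x\<^sup>2 * y ^ 3 * (x\<^sup>2 - y\<^sup>2) / (x\<^sup>2 + y\<^sup>2) ^ 3"
proof -
  have nz: "x\<^sup>2 + y\<^sup>2 \<noteq> 0" using out by auto
  have "((\<lambda>s. 4 * (s\<^sup>2 - y\<^sup>2) * s\<^sup>2 * y\<^sup>2 / (s\<^sup>2 + y\<^sup>2)\<^sup>2) has_real_derivative y\<^sup>2 * gx (x, y)) (at x)"
  proof (rule has_field_derivative_transform_within_open[where S = "{s. 1 / 16 < s\<^sup>2 + y\<^sup>2}"])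
    show "((\<lambda>s. y\<^sup>2 * (4 * (s\<^sup>2 - y\<^sup>2) * s\<^sup>2 * core_mollifier (s, y))) has_real_derivative y\<^sup>2 * gx (x, y)) (at x)"
      using g by (intro DERIV_cmult) (simp add: has_partials_def)
    show "open {s. 1 / 16 < s\<^sup>2 + y\<^sup>2}" by (intro open_Collect_less continuous_intros)
    show "x \<in> {s. 1 / 16 < s\<^sup>2 + y\<^sup>2}" using out by simp
    show "y\<^sup>2 * (4 * (s\<^sup>2 - y\<^sup>2) * s\<^sup>2 * core_mollifier (s, y)) = 4 * (s\<^sup>2 - y\<^sup>2) * s\<^sup>2 * y\<^sup>2 / (s\<^sup>2 + y\<^sup>2)\<^sup>2"
      if "s \<in> {s. 1 / 16 < s\<^sup>2 + y\<^sup>2}" for s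
      using that by (subst core_mollifier_outside) (simp_all only: mem_Collect_eq times_divide_eq_right mult.right_neutral mult_ac)
  qed
  moreover have "((\<lambda>s. 4 * (s\<^sup>2 - y\<^sup>2) * s\<^sup>2 * y\<^sup>2 / (s\<^sup>2 + y\<^sup>2)\<^sup>2) has_real_derivative
      (16 * x ^ 3 * y\<^sup>2 - 8 * x * y ^ 4) / (x\<^sup>2 + y\<^sup>2)\<^sup>2
           - 16 * x ^ 3 * y\<^sup>2 * (x\<^sup>2 - y\<^sup>2) / (x\<^sup>2 + y\<^sup>2) ^ 3) (at x)"
  proof -
    have "((\<lambda>s. 4 * (s\<^sup>2 - y\<^sup>2) * s\<^sup>2 * y\<^sup>2) has_real_derivative 16 * x ^ 3 * y\<^sup>2 - 8 * x * y ^ 4) (at x)"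
      by (rule derivative_eq_intros refl)+ (simp add: algebra_simps eval_nat_numeral)
    moreover have "((\<lambda>s. s\<^sup>2 + y\<^sup>2) has_real_derivative 2 * x) (at x)"
      by (rule derivative_eq_intros refl)+ simp
    moreover have e: "2 * (2 * x) * (4 * (x\<^sup>2 - y\<^sup>2) * x\<^sup>2 * y\<^sup>2) = 16 * x ^ 3 * y\<^sup>2 * (x\<^sup>2 - y\<^sup>2)"
      by algebra
    ultimately show ?thesis
      unfolding e[symmetric] by (intro DERIV_divide_square nz)
  qed
  ultimately show "y\<^sup>2 * gx (x, y) = (16 * x ^ 3 * y\<^sup>2 - 8 * x * y ^ 4) / (x\<^sup>2 + y\<^sup>2)\<^sup>2
           - 16 * x ^ 3 * y\<^sup>2 * (x\<^sup>2 - y\<^sup>2) / (x\<^sup>2 + y\<^sup>2) ^ 3"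
    by (rule DERIV_unique)
  have "((\<lambda>s. 4 * (x\<^sup>2 - s\<^sup>2) * x\<^sup>2 * s\<^sup>2 / (x\<^sup>2 + s\<^sup>2)\<^sup>2) has_real_derivative x\<^sup>2 * hy (x, y)) (at y)"
  proof (rule has_field_derivative_transform_within_open[where S = "{s. 1 / 16 < x\<^sup>2 + s\<^sup>2}"])
    show "((\<lambda>s. x\<^sup>2 * (4 * (x\<^sup>2 - s\<^sup>2) * s\<^sup>2 * core_mollifier (x, s))) has_real_derivative x\<^sup>2 * hy (x, y)) (at y)"
      using h by (intro DERIV_cmult) (simp add: has_partials_def)
    show "open {s. 1 / 16 < x\<^sup>2 + s\<^sup>2}" by (intro open_Collect_less continuous_intros)
    show "y \<in> {s. 1 / 16 < x\<^sup>2 + s\<^sup>2}" using out by simp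
    show "x\<^sup>2 * (4 * (x\<^sup>2 - s\<^sup>2) * s\<^sup>2 * core_mollifier (x, s)) = 4 * (x\<^sup>2 - s\<^sup>2) * x\<^sup>2 * s\<^sup>2 / (x\<^sup>2 + s\<^sup>2)\<^sup>2"
      if "s \<in> {s. 1 / 16 < x\<^sup>2 + s\<^sup>2}" for s
      using that by (subst core_mollifier_outside) (simp_all only: mem_Collect_eq times_divide_eq_right mult.right_neutral mult_ac)
  qed
  moreover have "((\<lambda>s. 4 * (x\<^sup>2 - s\<^sup>2) * x\<^sup>2 * s\<^sup>2 / (x\<^sup>2 + s\<^sup>2)\<^sup>2) has_real_derivative
      (8 * x ^ 4 * y - 16 * x\<^sup>2 * y ^ 3) / (x\<^sup>2 + y\<^sup>2)\<^sup>2
           - 16 * x\<^sup>2 * y ^ 3 * (x\<^sup>2 - y\<^sup>2) / (x\<^sup>2 + y\<^sup>2) ^ 3) (at y)"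
  proof -
    have "((\<lambda>s. 4 * (x\<^sup>2 - s\<^sup>2) * x\<^sup>2 * s\<^sup>2) has_real_derivative 8 * x ^ 4 * y - 16 * x\<^sup>2 * y ^ 3) (at y)"
      by (rule derivative_eq_intros refl)+ (simp add: algebra_simps eval_nat_numeral)
    moreover have "((\<lambda>s. x\<^sup>2 + s\<^sup>2) has_real_derivative 2 * y) (at y)"
      by (rule derivative_eq_intros refl)+ simp
    moreover have e: "2 * (2 * y) * (4 * (x\<^sup>2 - y\<^sup>2) * x\<^sup>2 * y\<^sup>2) = 16 * x\<^sup>2 * y ^ 3 * (x\<^sup>2 - y\<^sup>2)"
      by algebra
    ultimately show ?thesis
      unfolding e[symmetric] by (intro DERIV_divide_square nz)
  qed
  ultimately show "x\<^sup>2 * hy (x, y) = (8 * x ^ 4 * y - 16 * x\<^sup>2 * y ^ 3) / (x\<^sup>2 + y\<^sup>2)\<^sup>2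
           - 16 * x\<^sup>2 * y ^ 3 * (x\<^sup>2 - y\<^sup>2) / (x\<^sup>2 + y\<^sup>2) ^ 3"
    by (rule DERIV_unique)
qed

text \<open>
  Homogeneity of degree 2 outside the core: the field scales linearly with \<open>r\<close>.
\<close>

lemma polar_velocity:
  fixes r \<epsilon> \<tau> \<theta> :: real
  assumes r: "1 / 4 < r"
  defines "A \<equiv> 2 * \<epsilon> * (lobe \<theta> - \<tau>)" and "B \<equiv> turning_rate \<epsilon> \<theta>"
  shows "- Zx \<epsilon> \<tau> (r * cos \<theta>, r * sin \<theta>) = A * (r * cos \<theta>) - B * (r * sin \<theta>)"
    and "Zy \<epsilon> \<tau> (r * cos \<theta>, r * sin \<theta>) = A * (r * sin \<theta>) + B * (r * cos \<theta>)"
proof -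
  define C S where "C = cos \<theta>" and "S = sin \<theta>"
  have CS: "C\<^sup>2 + S\<^sup>2 = 1" by (simp add: C_def S_def)
  have double: "sin (2 * \<theta>) = 2 * S * C" "cos (2 * \<theta>) = C\<^sup>2 - S\<^sup>2"
    by (simp_all add: C_def S_def sin_double cos_double)
  have q: "(r * C)\<^sup>2 + (r * S)\<^sup>2 = r\<^sup>2"
    using CS by (simp add: power_mult_distrib flip: distrib_left)
  have out: "1 / 16 < (r * C)\<^sup>2 + (r * S)\<^sup>2"
    unfolding q using power_strict_mono[OF r, of 2] by (simp add: power2_eq_square)
  have nz: "r \<noteq> 0" using r by auto
  have gx_polar: "(r * S)\<^sup>2 * gx (r * C, r * S) = r * (16 * C ^ 3 * S\<^sup>2 - 8 * C * S ^ 4 - 16 * C ^ 3 * S\<^sup>2 * (C\<^sup>2 - S\<^sup>2))"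
    unfolding gradient_outside_core(1)[OF out] q
    using nz by (simp add: divide_simps) algebra
  have hy_polar: "(r * C)\<^sup>2 * hy (r * C, r * S) = r * (8 * C ^ 4 * S - 16 * C\<^sup>2 * S ^ 3 - 16 * C\<^sup>2 * S ^ 3 * (C\<^sup>2 - S\<^sup>2))"
    unfolding gradient_outside_core(2)[OF out] q
    using nz by (simp add: divide_simps) algebra
  have "16 * C ^ 3 * S\<^sup>2 - 8 * C * S ^ 4 - 16 * C ^ 3 * S\<^sup>2 * (C\<^sup>2 - S\<^sup>2)
      = 2 * ((2 * S * C)\<^sup>2 * (2 * (2 * S * C)\<^sup>2 - 1)) * C + 4 * (2 * S * C) * (C\<^sup>2 - S\<^sup>2) ^ 3 * S"
    using CS by algebra
  note gx_polar = gx_polar[unfolded this]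
  have "- Zx \<epsilon> \<tau> (r * C, r * S) = A * (r * C) - B * (r * S)"
    unfolding Zx_def fst_conv snd_conv gx_polar A_def B_def lobe_def turning_rate_def double by algebra
  then show "- Zx \<epsilon> \<tau> (r * cos \<theta>, r * sin \<theta>) = A * (r * cos \<theta>) - B * (r * sin \<theta>)"
    by (simp only: C_def S_def)
  have "8 * C ^ 4 * S - 16 * C\<^sup>2 * S ^ 3 - 16 * C\<^sup>2 * S ^ 3 * (C\<^sup>2 - S\<^sup>2)
      = - 2 * ((2 * S * C)\<^sup>2 * (2 * (2 * S * C)\<^sup>2 - 1)) * S + 4 * (2 * S * C) * (C\<^sup>2 - S\<^sup>2) ^ 3 * C"
    using CS by algebra
  note hy_polar = hy_polar[unfolded this]
  have "Zy \<epsilon> \<tau> (r * C, r * S) = A * (r * S) + B * (r * C)"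
    unfolding Zy_def fst_conv snd_conv hy_polar A_def B_def lobe_def turning_rate_def double by algebra
  then show "Zy \<epsilon> \<tau> (r * cos \<theta>, r * sin \<theta>) = A * (r * sin \<theta>) + B * (r * cos \<theta>)"
    by (simp only: C_def S_def)
qed

lemma saddle_smooth:
  "Z \<epsilon> \<tau> \<in> plane_smooth" "Zx \<epsilon> \<tau> \<in> plane_smooth" "Zxx \<epsilon> \<tau> \<in> plane_smooth" "Zy \<epsilon> \<tau> \<in> plane_smooth"
  unfolding Z_def[abs_def] Zx_def[abs_def] Zxx_def[abs_def] Zy_def[abs_def]
  by (intro plane_smooth_intros smooth core_mollifier_smooth)+

lemma small_parameter:
  assumes "0 < \<epsilon>" "1000 * M\<^sup>2 * \<epsilon> \<le> 1"
  shows "\<epsilon> \<le> 1 / 1000" "\<epsilon> * (2 + M) \<le> 1 / (16 * M)"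
proof -
  have "\<epsilon> \<le> M\<^sup>2 * \<epsilon>" using M(1) assms(1) by simp
  then show "\<epsilon> \<le> 1 / 1000" using assms(2) by simp
  have "16 * M * (\<epsilon> * (2 + M)) \<le> 16 * M * (\<epsilon> * (3 * M))"
    using M(1) assms(1) by (intro mult_left_mono) auto
  also have "\<dots> \<le> 1000 * M\<^sup>2 * \<epsilon>" using assms(1) M(1) by (simp add: power2_eq_square)
  also have "\<dots> \<le> 1" by (rule assms)
  finally show "\<epsilon> * (2 + M) \<le> 1 / (16 * M)"
    using M(1) by (simp add: le_divide_eq mult.commute)
qed

lemma square_small:
  assumes "\<bar>s\<bar> \<le> 1 / (8 * M)" "\<bar>v\<bar> \<le> M"
  shows "\<bar>s\<^sup>2 * v\<bar> \<le> 1 / 64"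
proof -
  have "s\<^sup>2 \<le> (1 / (8 * M))\<^sup>2" using assms(1) power_mono[of "\<bar>s\<bar>" "1 / (8 * M)" 2] by simp
  then have "s\<^sup>2 * \<bar>v\<bar> \<le> (1 / (8 * M))\<^sup>2 * M"
    using assms(2) M(1) by (intro mult_mono) auto
  also have "\<dots> = 1 / 64 * (1 / M)" using M(1) by (simp add: power2_eq_square)
  also have "\<dots> \<le> 1 / 64" using M(1) by simp
  finally show ?thesis by (simp add: abs_mult)
qed

lemma slope_perturbation_le:
  assumes "\<bar>s\<bar> \<le> 1" "\<bar>v\<bar> \<le> M" "0 \<le> \<tau>" "\<tau> \<le> 1"
  shows "\<bar>2 * \<tau> * r\<bar> + \<bar>s\<^sup>2 * v\<bar> \<le> 2 * \<bar>r\<bar> + M * \<bar>s\<bar>"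
proof -
  have "\<tau> * \<bar>r\<bar> \<le> 1 * \<bar>r\<bar>" using assms by (intro mult_right_mono) auto
  moreover have "s\<^sup>2 \<le> \<bar>s\<bar>"
    using mult_left_mono[OF assms(1), of "\<bar>s\<bar>"] by (simp add: power2_eq_square)
  then have "s\<^sup>2 * \<bar>v\<bar> \<le> \<bar>s\<bar> * M" using assms(2) by (intro mult_mono) auto
  ultimately show ?thesis using assms(3) by (simp add: abs_mult mult_ac)
qed

lemma slope_bounds:
  assumes "0 < \<epsilon>" "0 \<le> \<tau>" "\<tau> \<le> 1" "\<bar>x\<bar> \<le> 1" "\<bar>y\<bar> \<le> 1"
  shows "\<bar>Zx \<epsilon> \<tau> (x, y) - y\<bar> \<le> \<epsilon> * (2 * \<bar>x\<bar> + M * \<bar>y\<bar>)"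
    and "\<bar>Zy \<epsilon> \<tau> (x, y) - x\<bar> \<le> \<epsilon> * (2 * \<bar>y\<bar> + M * \<bar>x\<bar>)"
proof -
  have "\<bar>2 * \<tau> * x - y\<^sup>2 * gx (x, y)\<bar> \<le> 2 * \<bar>x\<bar> + M * \<bar>y\<bar>"
    using slope_perturbation_le[of y "gx (x, y)" \<tau> x] M(2)[of x y] assms by linarith
  then show "\<bar>Zx \<epsilon> \<tau> (x, y) - y\<bar> \<le> \<epsilon> * (2 * \<bar>x\<bar> + M * \<bar>y\<bar>)"
    using assms(1) by (simp add: Zx_def abs_mult)
  have "\<bar>2 * \<tau> * y + x\<^sup>2 * hy (x, y)\<bar> \<le> 2 * \<bar>y\<bar> + M * \<bar>x\<bar>"
    using slope_perturbation_le[of x "hy (x, y)" \<tau> y] M(2)[of x y] assms by linarith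
  then show "\<bar>Zy \<epsilon> \<tau> (x, y) - x\<bar> \<le> \<epsilon> * (2 * \<bar>y\<bar> + M * \<bar>x\<bar>)"
    using assms(1) by (simp add: Zy_def abs_mult)
qed

text \<open>
  The condition on \<open>\<epsilon>\<close> makes the perturbation of the slopes, at most \<open>\<epsilon> * (2 + M)\<close>, smaller than half the width of
  the strips around the axes, and bounds \<open>\<epsilon>\<close> by \<open>1 / 1000\<close>.
\<close>

context
  fixes \<epsilon> \<tau> :: real
  assumes \<epsilon>: "0 < \<epsilon>" "1000 * M\<^sup>2 * \<epsilon> \<le> 1" and \<tau>: "1 / 8 \<le> \<tau>" "\<tau> \<le> 1"
begin

text \<open>
  Used with \<open>s = y\<close>, \<open>d = Zx\<close> and with \<open>s = x\<close>, \<open>d = Zy\<close>: off the strip \<open>\<bar>s\<bar> \<le> 1 / (8 * M)\<close> the slope \<open>s\<close> of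
  \<open>x * y\<close> dominates the perturbation.
\<close>

lemma far_from_axis:
  assumes "\<bar>r\<bar> \<le> 1" "\<bar>s\<bar> \<le> 1" "1 / (8 * M) < \<bar>s\<bar>" "\<bar>d - s\<bar> \<le> \<epsilon> * (2 * \<bar>r\<bar> + M * \<bar>s\<bar>)"
  shows "1 / (16 * M) \<le> \<bar>d\<bar>"
proof -
  have "\<epsilon> * (2 * \<bar>r\<bar> + M * \<bar>s\<bar>) \<le> \<epsilon> * (2 * 1 + M * 1)"
    using assms \<epsilon>(1) M(1) by (intro mult_left_mono add_mono) auto
  then have "\<bar>d - s\<bar> \<le> 1 / (16 * M)"
    using assms(4) small_parameter(2)[OF \<epsilon>] by simp
  moreover have "1 / (8 * M) = 2 * (1 / (16 * M))" by simp
  ultimately show ?thesis using assms(3) by linarith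
qed

text \<open>
  Near the axis \<open>y = 0\<close>, the only place where \<open>Zx\<close> can be small, the quadratic term provides the curvature,
  because the factor \<open>y\<^sup>2\<close> makes the contribution of the compensating term negligible.
\<close>

lemma saddle_x_direction:
  assumes "\<bar>x\<bar> \<le> 1" "\<bar>y\<bar> \<le> 1"
  shows "\<epsilon> / 8 \<le> Zxx \<epsilon> \<tau> (x, y) \<or> 1 / (16 * M) \<le> \<bar>Zx \<epsilon> \<tau> (x, y)\<bar>"
proof (cases "\<bar>y\<bar> \<le> 1 / (8 * M)")
  case True
  then have "\<bar>y\<^sup>2 * gxx (x, y)\<bar> \<le> 1 / 64"
    using square_small M(2)[OF assms] by blast
  then have "1 / 8 \<le> 2 * \<tau> - y\<^sup>2 * gxx (x, y)" using \<tau> by linarith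
  then show ?thesis using mult_left_mono[of "1 / 8" "2 * \<tau> - y\<^sup>2 * gxx (x, y)" \<epsilon>] \<epsilon> by (simp add: Zxx_def)
next
  case False
  then show ?thesis
    using far_from_axis[of x y "Zx \<epsilon> \<tau> (x, y)"] slope_bounds(1)[of \<epsilon> \<tau> x y] assms \<epsilon> \<tau> by simp
qed

text \<open>
  The same alternative with the roles of the axes exchanged. The strip around \<open>x = 0\<close>
  consists of whole slices \<open>x = const\<close>.
\<close>

lemma saddle_y_direction:
  assumes "\<bar>x\<bar> \<le> 1"
  shows "(\<forall>y. \<bar>y\<bar> \<le> 1 \<longrightarrow> Zyy \<epsilon> \<tau> (x, y) \<le> - (\<epsilon> / 8)) \<or>
    (\<forall>y. \<bar>y\<bar> \<le> 1 \<longrightarrow> 1 / (16 * M) \<le> \<bar>Zy \<epsilon> \<tau> (x, y)\<bar>)"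
proof (cases "\<bar>x\<bar> \<le> 1 / (8 * M)")
  case True
  have "Zyy \<epsilon> \<tau> (x, y) \<le> - (\<epsilon> / 8)" if "\<bar>y\<bar> \<le> 1" for y
  proof -
    have "\<bar>x\<^sup>2 * hyy (x, y)\<bar> \<le> 1 / 64"
      using square_small[OF True] M(2)[OF assms that] by blast
    then have "1 / 8 \<le> 2 * \<tau> + x\<^sup>2 * hyy (x, y)" using \<tau> by linarith
    then show ?thesis using mult_left_mono[of "1 / 8" "2 * \<tau> + x\<^sup>2 * hyy (x, y)" \<epsilon>] \<epsilon> by (simp add: Zyy_def)
  qed
  then show ?thesis by blast
next
  case False
  then show ?thesis
    using far_from_axis[of _ x "Zy \<epsilon> \<tau> (x, _)"] slope_bounds(2)[of \<epsilon> \<tau> x] assms \<epsilon> \<tau> by simp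
qed

lemma saddle_critical_point:
  assumes "\<bar>x\<bar> \<le> 1" "\<bar>y\<bar> \<le> 1" "Zx \<epsilon> \<tau> (x, y) = 0" "Zy \<epsilon> \<tau> (x, y) = 0"
  shows "x = 0" "y = 0"
proof -
  have "\<bar>x\<bar> + \<bar>y\<bar> \<le> \<epsilon> * (2 + M) * (\<bar>x\<bar> + \<bar>y\<bar>)"
    using slope_bounds[of \<epsilon> \<tau> x y] assms \<epsilon> \<tau> by (simp add: algebra_simps)
  also have "\<dots> \<le> 1 / 16 * (\<bar>x\<bar> + \<bar>y\<bar>)"
  proof (rule mult_right_mono)
    have "1 / (16 * M) \<le> 1 / 16" using M(1) by simp
    then show "\<epsilon> * (2 + M) \<le> 1 / 16" using small_parameter(2)[OF \<epsilon>] by linarith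
  qed simp
  finally have "\<bar>x\<bar> + \<bar>y\<bar> \<le> 0" by simp
  then show "x = 0" "y = 0" by linarith+
qed

text \<open>
  The orbit through \<open>p\<close> is \<open>r = r\<^sub>0 * exp (R \<theta> - R \<theta>\<^sub>0)\<close> in polar coordinates. It is closed since \<open>R\<close> is periodic, and it stays between
  the core and the boundary of the square since \<open>R\<close> oscillates by \<open>O(\<epsilon>)\<close> only. The factor
  \<open>K * exp (K * Z)\<close> of the gradient of \<open>exp (K * Z)\<close> changes the speed along the orbit but not its trace.
\<close>

lemma saddle_closed_orbit:
  assumes R: "\<And>\<theta>. (R has_real_derivative 2 * \<epsilon> * (lobe \<theta> - \<tau>) / turning_rate \<epsilon> \<theta>) (at \<theta>)"
    and R_per: "\<And>\<theta>. R (\<theta> + 2 * pi) = R \<theta>"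
    and p: "2 / 5 < norm p" "norm p < 3 / 5" and "0 < K"
  defines "V \<equiv> \<lambda>q. (- (K * exp (K * Z \<epsilon> \<tau> q) * Zx \<epsilon> \<tau> q), K * exp (K * Z \<epsilon> \<tau> q) * Zy \<epsilon> \<tau> q)"
  shows "\<exists>z. \<exists>T>0. z 0 = p \<and>
    (\<forall>t. z (t + T) = z t \<and> z t \<in> square \<and> (z has_vector_derivative V (z t)) (at t))"
proof -
  define r\<^sub>0 where "r\<^sub>0 = norm p"
  have "r\<^sub>0 > 0" unfolding r\<^sub>0_def using p by linarith
  have "(fst p / r\<^sub>0)\<^sup>2 + (snd p / r\<^sub>0)\<^sup>2 = 1"
  proof -
    have "(fst p)\<^sup>2 + (snd p)\<^sup>2 = r\<^sub>0\<^sup>2" by (simp add: r\<^sub>0_def norm_prod_def)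
    then show ?thesis using \<open>r\<^sub>0 > 0\<close> by (simp add: power_divide flip: add_divide_distrib)
  qed
  then obtain \<theta>\<^sub>0 where "fst p / r\<^sub>0 = cos \<theta>\<^sub>0" "snd p / r\<^sub>0 = sin \<theta>\<^sub>0"
    using sincos_total_2pi by metis
  then have p_polar: "p = (r\<^sub>0 * cos \<theta>\<^sub>0, r\<^sub>0 * sin \<theta>\<^sub>0)"
    using \<open>r\<^sub>0 > 0\<close> by (simp add: prod_eq_iff field_simps)
  have B: "1 / 2 \<le> turning_rate \<epsilon> \<theta>" for \<theta>
    using abs_turning_rate[of \<epsilon> \<theta>] small_parameter(1)[OF \<epsilon>] \<epsilon>(1) by linarith
  have "\<bar>2 * \<epsilon> * (lobe \<theta> - \<tau>) / turning_rate \<epsilon> \<theta>\<bar> \<le> (2 * \<epsilon> * 2) / (1 / 2)" for \<theta>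
    unfolding abs_divide abs_mult using abs_lobe_le[of \<theta>] \<epsilon>(1) \<tau> B[of \<theta>]
    by (intro frac_le mult_mono) auto
  then have "\<bar>R \<theta> - R \<theta>\<^sub>0\<bar> \<le> (2 * \<epsilon> * 2) / (1 / 2) * (2 * pi)" for \<theta>
    by (rule periodic_oscillation_le[OF R _ R_per]) simp
  moreover have "(2 * \<epsilon> * 2) / (1 / 2) * (2 * pi) \<le> 1 / 10"
  proof -
    have "\<epsilon> * pi \<le> 1 / 1000 * 4"
      using small_parameter(1)[OF \<epsilon>] \<epsilon>(1) pi_less_4 by (intro mult_mono) auto
    then show ?thesis by simp
  qed
  ultimately have R_bound: "\<bar>R \<theta> - R \<theta>\<^sub>0\<bar> \<le> 1 / 10" for \<theta> by (meson order_trans)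
  define \<rho> where "\<rho> \<theta> = r\<^sub>0 * exp (R \<theta> - R \<theta>\<^sub>0)" for \<theta>
  \<comment> \<open>Above \<open>1 / 4\<close> the orbit stays in the homogeneous region, below \<open>1\<close> inside the square.\<close>
  have \<rho>_range: "1 / 4 < \<rho> \<theta>" "\<rho> \<theta> < 1" for \<theta>
  proof -
    have "9 / 10 \<le> exp (R \<theta> - R \<theta>\<^sub>0)"
      using R_bound[of \<theta>] exp_ge_add_one_self[of "R \<theta> - R \<theta>\<^sub>0"] by linarith
    then have "2 / 5 * (9 / 10) \<le> \<rho> \<theta>"
      unfolding \<rho>_def using p by (intro mult_mono) (auto simp: r\<^sub>0_def)
    then show "1 / 4 < \<rho> \<theta>" by simp
    have "9 / 10 \<le> exp (- (R \<theta> - R \<theta>\<^sub>0))"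
      using R_bound[of \<theta>] exp_ge_add_one_self[of "- (R \<theta> - R \<theta>\<^sub>0)"] by linarith
    then have "exp (R \<theta> - R \<theta>\<^sub>0) * (9 / 10) \<le> exp (R \<theta> - R \<theta>\<^sub>0) * exp (- (R \<theta> - R \<theta>\<^sub>0))"
      by (intro mult_left_mono) auto
    also have "\<dots> = 1" by (simp flip: exp_add)
    finally have "exp (R \<theta> - R \<theta>\<^sub>0) \<le> 10 / 9" by simp
    then have "\<rho> \<theta> \<le> 3 / 5 * (10 / 9)"
      unfolding \<rho>_def using p by (intro mult_mono) (auto simp: r\<^sub>0_def)
    then show "\<rho> \<theta> < 1" by simp
  qed
  define \<gamma> where "\<gamma> \<theta> = (\<rho> \<theta> * cos \<theta>, \<rho> \<theta> * sin \<theta>)" for \<theta>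
  define \<omega> where "\<omega> \<theta> = turning_rate \<epsilon> \<theta> * (K * exp (K * Z \<epsilon> \<tau> (\<gamma> \<theta>)))" for \<theta>
  have \<rho>': "(\<rho> has_real_derivative \<rho> \<theta> * (2 * \<epsilon> * (lobe \<theta> - \<tau>) / turning_rate \<epsilon> \<theta>)) (at \<theta>)" for \<theta>
    unfolding \<rho>_def using R[of \<theta>] by (auto intro!: derivative_eq_intros)
  have \<gamma>': "(\<gamma> has_vector_derivative (1 / \<omega> \<theta>) *\<^sub>R V (\<gamma> \<theta>)) (at \<theta>)" for \<theta>
  proof -
    let ?A = "2 * \<epsilon> * (lobe \<theta> - \<tau>)" and ?B = "turning_rate \<epsilon> \<theta>"
    have "(\<gamma> has_vector_derivative
        (\<rho> \<theta> * (?A / ?B) * cos \<theta> - \<rho> \<theta> * sin \<theta>, \<rho> \<theta> * (?A / ?B) * sin \<theta> + \<rho> \<theta> * cos \<theta>)) (at \<theta>)"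
      unfolding \<gamma>_def
      by (intro has_vector_derivative_Pair)
        (auto intro!: derivative_eq_intros \<rho>' simp: has_real_derivative_iff_has_vector_derivative[symmetric])
    moreover have "(1 / \<omega> \<theta>) *\<^sub>R V (\<gamma> \<theta>) = (1 / ?B) *\<^sub>R (- Zx \<epsilon> \<tau> (\<gamma> \<theta>), Zy \<epsilon> \<tau> (\<gamma> \<theta>))"
      using \<open>0 < K\<close> by (simp add: V_def \<omega>_def)
    moreover have "\<dots> = (\<rho> \<theta> * (?A / ?B) * cos \<theta> - \<rho> \<theta> * sin \<theta>, \<rho> \<theta> * (?A / ?B) * sin \<theta> + \<rho> \<theta> * cos \<theta>)"
    proof -
      have "?B \<noteq> 0" using B[of \<theta>] by linarith
      then show ?thesis
        unfolding \<gamma>_def polar_velocity[OF \<rho>_range(1)] by (simp add: diff_divide_distrib add_divide_distrib)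
    qed
    ultimately show ?thesis by simp
  qed
  have "continuous_on UNIV \<gamma>"
    using \<gamma>' has_vector_derivative_continuous by (blast intro: continuous_at_imp_continuous_on)
  then have "continuous_on UNIV (\<lambda>\<theta>. Z \<epsilon> \<tau> (\<gamma> \<theta>))"
    by (rule continuous_on_compose2[OF plane_smooth_continuous[OF saddle_smooth(1), of UNIV]]) simp
  then have \<omega>_cont: "continuous_on UNIV \<omega>"
    unfolding \<omega>_def turning_rate_def by (intro continuous_intros)
  have \<gamma>_per: "\<gamma> (\<theta> + 2 * pi) = \<gamma> \<theta>" for \<theta> by (simp add: \<gamma>_def \<rho>_def R_per)
  have \<omega>_per: "\<omega> (\<theta> + 2 * pi) = \<omega> \<theta>" for \<theta> by (simp add: \<omega>_def \<gamma>_per turning_rate_periodic)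
  have \<omega>_pos: "0 < \<omega> \<theta>" for \<theta> using B[of \<theta>] \<open>0 < K\<close> by (auto simp: \<omega>_def)
  have \<gamma>_square: "\<gamma> \<theta> \<in> square" for \<theta>
  proof -
    have "\<bar>\<rho> \<theta>\<bar> * \<bar>cos \<theta>\<bar> \<le> 1 * 1" "\<bar>\<rho> \<theta>\<bar> * \<bar>sin \<theta>\<bar> \<le> 1 * 1"
      using \<rho>_range[of \<theta>] by (intro mult_mono; simp)+
    then show ?thesis by (auto simp: \<gamma>_def abs_le_iff simp flip: abs_mult)
  qed
  have "0 < 2 * pi" by simp
  from closed_orbit_reparametrization[where \<theta>\<^sub>0 = \<theta>\<^sub>0, OF \<gamma>' \<omega>_pos \<omega>_cont \<gamma>_per \<omega>_per this]
  obtain z T where T: "0 < T" and z: "z 0 = \<gamma> \<theta>\<^sub>0" "\<And>t. z (t + T) = z t" "\<And>t. z t \<in> range \<gamma>"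
    "\<And>t. (z has_vector_derivative V (z t)) (at t)"
    by blast
  have "z t \<in> square" for t using z(3)[of t] \<gamma>_square by (metis rangeE)
  moreover have "z 0 = p" by (simp add: z(1) \<gamma>_def \<rho>_def p_polar)
  ultimately show ?thesis
    using T z(2,4) by (intro exI[of _ z] exI[of _ T] conjI allI)
qed

end

end

section \<open>A descent-ascent flow with a ring of periodic orbits\<close>

lemma spinning_saddle_exists:
  obtains gx gxx gxy hy hyx hyy gy hx M where "spinning_saddle gx gxx gxy hy hyx hyy gy hx M"
proof -
  let ?g = "\<lambda>p. 4 * ((fst p)\<^sup>2 - (snd p)\<^sup>2) * (fst p)\<^sup>2 * core_mollifier p"
  let ?h = "\<lambda>p. 4 * ((fst p)\<^sup>2 - (snd p)\<^sup>2) * (snd p)\<^sup>2 * core_mollifier p"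
  have "?g \<in> plane_smooth" "?h \<in> plane_smooth"
    by (intro plane_smooth_intros core_mollifier_smooth)+
  then obtain gx gy hx hy where 1: "has_partials ?g gx gy" "has_partials ?h hx hy"
    and 2: "gx \<in> plane_smooth" "hy \<in> plane_smooth"
    using plane_smooth_has_partials by meson
  obtain gxx gxy hyx hyy where 3: "has_partials gx gxx gxy" "has_partials hy hyx hyy"
    and 4: "gxx \<in> plane_smooth" "hyy \<in> plane_smooth"
    using plane_smooth_has_partials[OF 2(1)] plane_smooth_has_partials[OF 2(2)] by blast
  obtain M1 where M1: "0 < M1" "\<And>x y. \<bar>x\<bar> \<le> 1 \<Longrightarrow> \<bar>y\<bar> \<le> 1 \<Longrightarrow> \<bar>gx (x, y)\<bar> \<le> M1"
    using plane_smooth_bounded[OF 2(1)] by blast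
  obtain M2 where M2: "0 < M2" "\<And>x y. \<bar>x\<bar> \<le> 1 \<Longrightarrow> \<bar>y\<bar> \<le> 1 \<Longrightarrow> \<bar>gxx (x, y)\<bar> \<le> M2"
    using plane_smooth_bounded[OF 4(1)] by blast
  obtain M3 where M3: "0 < M3" "\<And>x y. \<bar>x\<bar> \<le> 1 \<Longrightarrow> \<bar>y\<bar> \<le> 1 \<Longrightarrow> \<bar>hy (x, y)\<bar> \<le> M3"
    using plane_smooth_bounded[OF 2(2)] by blast
  obtain M4 where M4: "0 < M4" "\<And>x y. \<bar>x\<bar> \<le> 1 \<Longrightarrow> \<bar>y\<bar> \<le> 1 \<Longrightarrow> \<bar>hyy (x, y)\<bar> \<le> M4"
    using plane_smooth_bounded[OF 4(2)] by blast
  have "spinning_saddle gx gxx gxy hy hyx hyy gy hx (1 + M1 + M2 + M3 + M4)"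
  proof
    show "\<bar>gx (x, y)\<bar> \<le> 1 + M1 + M2 + M3 + M4 \<and> \<bar>gxx (x, y)\<bar> \<le> 1 + M1 + M2 + M3 + M4 \<and>
      \<bar>hy (x, y)\<bar> \<le> 1 + M1 + M2 + M3 + M4 \<and> \<bar>hyy (x, y)\<bar> \<le> 1 + M1 + M2 + M3 + M4"
      if "\<bar>x\<bar> \<le> 1" "\<bar>y\<bar> \<le> 1" for x y
      using M1(2)[OF that] M2(2)[OF that] M3(2)[OF that] M4(2)[OF that] M1(1) M2(1) M3(1) M4(1)
      by linarith
  qed (use 1 2 3 4 M1(1) M2(1) M3(1) M4(1) in simp_all)
  then show thesis by (rule that)
qed

theorem corollary1p2:
  "\<exists>(F :: real \<times> real \<Rightarrow> real) (C :: real).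
     smooth_on_square F \<and>
     (\<forall>p. critical_point F p \<longleftrightarrow> p = (0, 0)) \<and>
     0 < C \<and>
     (\<forall>x\<in>{-1..1}. \<forall>y\<in>{-1..1}.
        partial_x (partial_x F) (x, y) \<ge> inverse C \<and>
        (SUP y'\<in>{-1..1}. F (x, y')) - F (x, y) \<le> C * \<bar>partial_y F (x, y)\<bar>\<^sup>2) \<and>
     (\<exists>U. openin (top_of_set square) U \<and> U \<noteq> {} \<and>
        (\<forall>z0\<in>U. (\<exists>z. gda_flow F z0 z) \<and>
                 (\<forall>z. gda_flow F z0 z \<longrightarrow> periodic_flow z)))"
proof -
  obtain gx gxx gxy hy hyx hyy gy hx M where "spinning_saddle gx gxx gxy hy hyx hyy gy hx M"
    by (rule spinning_saddle_exists)
  then interpret spinning_saddle gx gxx gxy hy hyx hyy gy hx M .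
  define \<epsilon> where "\<epsilon> = 1 / (1000 * M\<^sup>2)"
  have \<epsilon>: "0 < \<epsilon>" "1000 * M\<^sup>2 * \<epsilon> \<le> 1" using M(1) by (simp_all add: \<epsilon>_def)
  obtain \<tau> R where \<tau>: "1 / 8 \<le> \<tau>" "\<tau> \<le> 1"
    and R: "\<And>\<theta>. (R has_real_derivative 2 * \<epsilon> * (lobe \<theta> - \<tau>) / turning_rate \<epsilon> \<theta>) (at \<theta>)"
    and R_per: "\<And>\<theta>. R (\<theta> + 2 * pi) = R \<theta>"
    using closing_coefficient_exists[OF \<epsilon>(1) small_parameter(1)[OF \<epsilon>]] by blast
  have "0 < \<epsilon> / 8" "0 < 1 / (16 * M)" using \<epsilon>(1) M(1) by simp_all
  from exponential_of_saddle_is_convex_PL[OF saddle_smooth(1,3) Z_partials Zy_partials this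
      saddle_x_direction[OF \<epsilon> \<tau>] saddle_y_direction[OF \<epsilon> \<tau>]]
  obtain K C where K: "0 < K" and C: "0 < C" and KC: "\<And>x y. \<bar>x\<bar> \<le> 1 \<Longrightarrow> \<bar>y\<bar> \<le> 1 \<Longrightarrow>
    inverse C \<le> K * exp (K * Z \<epsilon> \<tau> (x, y)) * (K * (Zx \<epsilon> \<tau> (x, y))\<^sup>2 + Zxx \<epsilon> \<tau> (x, y)) \<and>
    (\<forall>y'. \<bar>y'\<bar> \<le> 1 \<longrightarrow> exp (K * Z \<epsilon> \<tau> (x, y')) - exp (K * Z \<epsilon> \<tau> (x, y))
       \<le> C * (K * exp (K * Z \<epsilon> \<tau> (x, y)) * Zy \<epsilon> \<tau> (x, y))\<^sup>2)"
    by blast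
  define F where "F p = exp (K * Z \<epsilon> \<tau> p)" for p
  define Fx where "Fx p = K * exp (K * Z \<epsilon> \<tau> p) * Zx \<epsilon> \<tau> p" for p
  define Fy where "Fy p = K * exp (K * Z \<epsilon> \<tau> p) * Zy \<epsilon> \<tau> p" for p
  have F_partials: "has_partials F Fx Fy"
    unfolding F_def[abs_def] Fx_def[abs_def] Fy_def[abs_def]
    by (rule exp_partials(1)[OF Z_partials Zx_partials])
  have F_smooth: "F \<in> plane_smooth" "(\<lambda>p. - 1 * Fx p) \<in> plane_smooth" "Fy \<in> plane_smooth"
    unfolding F_def[abs_def] Fx_def[abs_def] Fy_def[abs_def]
    by (intro plane_smooth_intros saddle_smooth)+
  have DF: "partial_x F p = Fx p" "partial_y F p = Fy p" if "p \<in> square" for p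
    using partial_eq[OF F_partials] that by auto
  have DxxF: "partial_x (partial_x F) (x, y) =
      K * exp (K * Z \<epsilon> \<tau> (x, y)) * (K * (Zx \<epsilon> \<tau> (x, y))\<^sup>2 + Zxx \<epsilon> \<tau> (x, y))"
    if "x \<in> {-1..1}" "y \<in> {-1..1}" for x y
  proof -
    have "partial_x (partial_x F) (x, y) = partial_x Fx (x, y)"
      using DF that by (intro partial_cong) auto
    also have "\<dots> = K * exp (K * Z \<epsilon> \<tau> (x, y)) * (K * (Zx \<epsilon> \<tau> (x, y))\<^sup>2 + Zxx \<epsilon> \<tau> (x, y))"
      unfolding partial_x_def Fx_def prod.case
      by (rule partials_eqI[OF that(1) exp_partials(2)[OF Z_partials Zx_partials]])
    finally show ?thesis .
  qed
  have convex_PL: "partial_x (partial_x F) (x, y) \<ge> inverse C \<and>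
      (SUP y'\<in>{-1..1}. F (x, y')) - F (x, y) \<le> C * \<bar>partial_y F (x, y)\<bar>\<^sup>2"
    if xy: "x \<in> {-1..1}" "y \<in> {-1..1}" for x y
  proof -
    have abs: "\<bar>x\<bar> \<le> 1" "\<bar>y\<bar> \<le> 1" using xy by auto
    have "(SUP y'\<in>{-1..1}. F (x, y')) \<le> F (x, y) + C * (Fy (x, y))\<^sup>2"
    proof (rule cSUP_least)
      fix y' :: real assume "y' \<in> {-1..1}"
      then have "\<bar>y'\<bar> \<le> 1" by auto
      then show "F (x, y') \<le> F (x, y) + C * (Fy (x, y))\<^sup>2"
        using KC[OF abs] by (auto simp: F_def Fy_def algebra_simps)
    qed simp
    then show ?thesis
      using KC[OF abs] DxxF[OF xy] DF(2)[of "(x, y)"] xy by simp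
  qed
  have crit: "critical_point F p \<longleftrightarrow> p = (0, 0)" for p
  proof
    assume "critical_point F p"
    then have "p \<in> square" "Fx p = 0" "Fy p = 0" using DF by (auto simp: critical_point_def)
    then show "p = (0, 0)"
      using saddle_critical_point[OF \<epsilon> \<tau>, of "fst p" "snd p"] K
      by (auto simp: Fx_def Fy_def prod_eq_iff abs_le_iff)
  next
    assume "p = (0, 0)"
    then show "critical_point F p"
      using DF[of "(0, 0)"] by (simp add: critical_point_def Fx_def Fy_def Zx_def Zy_def)
  qed
  define U where "U = square \<inter> {p. 2 / 5 < norm p \<and> norm p < 3 / 5}"
  have "open {p :: real \<times> real. 2 / 5 < norm p \<and> norm p < 3 / 5}"
    by (intro open_Collect_conj open_Collect_less continuous_intros)
  then have U_open: "openin (top_of_set square) U"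
    unfolding U_def by (rule openin_open_Int)
  have "(1 / 2, 0) \<in> U" by (simp add: U_def norm_Pair)
  then have U_nonempty: "U \<noteq> {}" by blast
  have flows: "(\<exists>z. gda_flow F p z) \<and> (\<forall>z. gda_flow F p z \<longrightarrow> periodic_flow z)" if "p \<in> U" for p
  proof -
    have p: "2 / 5 < norm p" "norm p < 3 / 5" using that by (auto simp: U_def)
    obtain w T where T: "0 < T" and w: "w 0 = p" "\<And>t. w (t + T) = w t" "\<And>t. w t \<in> square"
      "\<And>t. (w has_vector_derivative (- Fx (w t), Fy (w t))) (at t)"
      using saddle_closed_orbit[OF \<epsilon> \<tau> R R_per p K]
      unfolding Fx_def[symmetric] Fy_def[symmetric] by blast
    have w': "w t \<in> square \<and> (w has_vector_derivative (- 1 * Fx (w t), Fy (w t))) (at t within {0..})" for t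
      using w(3,4)[of t] by (simp add: has_vector_derivative_at_within)
    have "gda_flow F p w"
      using w'  w(1) DF[OF w(3)] by (simp add: gda_flow_def)
    moreover have "periodic_flow z" if "gda_flow F p z" for z
    proof -
      have z: "z t \<in> square \<and> (z has_vector_derivative (- 1 * Fx (z t), Fy (z t))) (at t within {0..})"
        if "0 \<le> t" for t
      proof -
        have "z t \<in> square"
          "(z has_vector_derivative (- partial_x F (z t), partial_y F (z t))) (at t within {0..})"
          using \<open>gda_flow F p z\<close> that unfolding gda_flow_def by blast+
        then show ?thesis using DF[of "z t"] by simp
      qed
      have "z 0 = w 0" using \<open>gda_flow F p z\<close> w(1) by (simp add: gda_flow_def)
      then have "z t = w t" if "0 \<le> t" for t
        using flow_unique[OF F_smooth(2,3) z w' _ that] by blast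
      then show ?thesis using T w(2) by (auto simp: periodic_flow_def intro!: exI[of _ T])
    qed
    ultimately show ?thesis by blast
  qed
  show ?thesis
    using plane_smooth_imp_smooth_on_square[OF F_smooth(1)] crit C convex_PL U_open U_nonempty flows
    by (intro exI[of _ F] exI[of _ C] conjI exI[of _ U]) blast+
qed

end
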